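(* Let $k,q,d,r\in\mathbb{N}$ with $k\geq2$ and $q,d,r\geq1$. Then there exists a positive integer $N$ with the following property. If $n\geq N$ and $\mathcal{L}$ is a set of cardinality $q$ which is disjoint from $[k]$, then for every Carlson--Simpson sequence $\mathbf{w}=(w,w_0,\dots,w_{n-1})$ over $k$ and every $r$-coloring of $\mathbf{w}(k,\mathcal{L})$ there exists a Carlson--Simpson subsequence $\mathbf{v}=(v,v_0,\dots,v_{d-1})$ of $\mathbf{w}$ such that for every type $\tau$ of $\mathrm{W}(k,\mathcal{L})$ the set of all words in $\mathbf{v}(k,\mathcal{L})$ of type $\tau$ is either empty or monochromatic. Denote the least integer $N$ with this property by $\mathrm{FK}(k,q,d,r)$. Moreover, there exists a primitive recursive function $\varphi:\mathbb{N}^4\to\mathbb{N}$ belonging to the class $\mathcal{E}^6$ of Grzegorczyk's hierarchy such that $\mathrm{FK}(k,q,d,r)\leq\varphi(k,q,d,r)$ for every $k,q,d,r\in\mathbb{N}$ with $k\geq2$ and $q,d,r\geq1$.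
   Context: $\mathbb{N}=\{0,1,2,\dots\}$ and $[k]=\{1,\dots,k\}$. A word over $k$ is a finite (possibly empty) sequence with values in $[k]$; $[k]^{<\mathbb{N}}$ is the set of all words over $k$; concatenation is denoted $u\circ v$. Fix a letter $x$ (a variable), not in $[k]$ or $\mathcal{L}$. A left variable word over $k$ is a finite nonempty sequence with values in $[k]\cup\{x\}$ whose first letter is $x$; for any letter $a$, $w(a)$ is the sequence obtained by replacing every occurrence of $x$ in $w$ by $a$. An $r$-coloring of a set is a map from it to $[r]$; a set is monochromatic if the coloring is constant on it. A Carlson--Simpson sequence over $k$ of dimension $n\geq1$ is a sequence $(w,w_0,\dots,w_{n-1})$ with $w$ a word over $k$ and $w_0,\dots,w_{n-1}$ left variable words over $k$. A Carlson--Simpson sequence $\mathbf{v}=(v,v_0,\dots,v_{d-1})$ over $k$ is a ($d$-dimensional) Carlson--Simpson subsequence of $\mathbf{w}=(w,w_0,\dots,w_{n-1})$ if there exist $a_0,\dots,a_{n-1}\in[k]\cup\{x\}$ and $0\leq n_0<n_1<\dots<n_d\leq n$ such that: (C1) $a_{n_i}=x$ for every $i\in\{0,\dots,d-1\}$; (C2) $a_0,\dots,a_{n_0-1}\in[k]$ and $v=w\circ w_0(a_0)\circ\cdots\circ w_{n_0-1}(a_{n_0-1})$ ($v=w$ if $n_0=0$); (C3) $v_i=w_{n_i}(a_{n_i})\circ w_{n_i+1}(a_{n_i+1})\circ\cdots\circ w_{n_{i+1}-1}(a_{n_{i+1}-1})$ for every $i\in\{0,\dots,d-1\}$. $\mathrm{W}(k,\mathcal{L})$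 is the set of all words (finite sequences) over the alphabet $[k]\cup\mathcal{L}$. A type of $\mathrm{W}(k,\mathcal{L})$ is a nonempty finite sequence in $\mathcal{L}$ in which no two consecutive letters are equal. The type of $w\in\mathrm{W}(k,\mathcal{L})\setminus[k]^{<\mathbb{N}}$ is obtained by deleting all letters of $w$ belonging to $[k]$ and then collapsing each maximal run of equal letters of the resulting sequence to a single letter. For $\mathbf{w}=(w,w_0,\dots,w_{n-1})$ a Carlson--Simpson sequence over $k$ and $v=(a_0,\dots,a_{m-1})\in\mathrm{W}(k,\mathcal{L})$ with $m\leq n$, set $\mathbf{w}(v)=w\circ w_0(a_0)\circ\cdots\circ w_{m-1}(a_{m-1})$ ($\mathbf{w}(v)=w$ if $v$ is empty), and $\mathbf{w}(k,\mathcal{L})=\{\mathbf{w}(v):v\in\mathrm{W}(k,\mathcal{L})\text{ of length at most }n\}$. *)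

theory Defs
  imports Main
begin

section \<open>Words, left variable words and Carlson--Simpson sequences\<close>

text \<open>
  All words live over one universe of letters: \<open>[k]\<close> is \<open>digits k\<close>, the variable \<open>x\<close> is \<open>X\<close>, and
  the alphabet \<open>\<L>\<close> is any set of letters \<open>L\<close> with \<open>X \<notin> L\<close> and \<open>L \<inter> digits k = {}\<close>. The type
  parameter admits the elements of an arbitrary type as letters. The universe is infinite whatever
  \<^typ>\<open>'l\<close> is; at the end of this theory it is proved that the choice of \<^typ>\<open>'l\<close> does not matter.
\<close>

datatype 'l letter = Num nat | Sym 'l | X

definition digits :: "nat \<Rightarrow> 'l letter set" where
  "digits k = Num ` {1..k}"

definition left_variable_word :: "nat \<Rightarrow> 'l letter list \<Rightarrow> bool" where
  "left_variable_word k u \<longleftrightarrow> u \<noteq> [] \<and> set u \<subseteq> digits k \<union> {X} \<and> hd u = X"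

definition subst :: "'l letter \<Rightarrow> 'l letter list \<Rightarrow> 'l letter list" where
  "subst a u = map (\<lambda>b. if b = X then a else b) u"

text \<open>The sequence \<open>(w, w\<^sub>0, \<dots>, w\<^sub>n\<^sub>-\<^sub>1)\<close> is represented by the pair \<open>(w, [w\<^sub>0, \<dots>, w\<^sub>n\<^sub>-\<^sub>1])\<close>.\<close>

type_synonym 'l cs_seq = "'l letter list \<times> 'l letter list list"

definition carlson_simpson :: "nat \<Rightarrow> nat \<Rightarrow> 'l cs_seq \<Rightarrow> bool" where
  "carlson_simpson k n W \<longleftrightarrow> 1 \<le> n \<and> length (snd W) = n \<and> set (fst W) \<subseteq> digits k \<and>
     (\<forall>u \<in> set (snd W). left_variable_word k u)"

text \<open>The increasing numbers \<open>n\<^sub>0 < \<dots> < n\<^sub>d\<close> are \<open>m 0, \<dots>, m d\<close>.\<close>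

definition cs_subsequence :: "nat \<Rightarrow> nat \<Rightarrow> 'l cs_seq \<Rightarrow> 'l cs_seq \<Rightarrow> bool" where
  "cs_subsequence k d V W \<longleftrightarrow> carlson_simpson k d V \<and>
     (\<exists>(a :: nat \<Rightarrow> 'l letter) (m :: nat \<Rightarrow> nat).
        (\<forall>j < length (snd W). a j \<in> digits k \<union> {X}) \<and>
        (\<forall>i < d. m i < m (Suc i)) \<and> m d \<le> length (snd W) \<and>
        (\<forall>i < d. a (m i) = X) \<and>
        (\<forall>j < m 0. a j \<in> digits k) \<and>
        fst V = fst W @ concat (map (\<lambda>j. subst (a j) (snd W ! j)) [0..<m 0]) \<and>
        (\<forall>i < d. snd V ! i = concat (map (\<lambda>j. subst (a j) (snd W ! j)) [m i..<m (Suc i)])))"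

definition cs_apply :: "'l cs_seq \<Rightarrow> 'l letter list \<Rightarrow> 'l letter list" where
  "cs_apply W v = fst W @ concat (map (\<lambda>j. subst (v ! j) (snd W ! j)) [0..<length v])"

definition cs_words :: "nat \<Rightarrow> 'l letter set \<Rightarrow> 'l cs_seq \<Rightarrow> 'l letter list set" where
  "cs_words k L W = {cs_apply W v | v. set v \<subseteq> digits k \<union> L \<and> length v \<le> length (snd W)}"


section \<open>Types\<close>

definition is_type :: "'l letter set \<Rightarrow> 'l letter list \<Rightarrow> bool" where
  "is_type L \<tau> \<longleftrightarrow> \<tau> \<noteq> [] \<and> set \<tau> \<subseteq> L \<and> distinct_adj \<tau>"

definition word_type :: "nat \<Rightarrow> 'l letter list \<Rightarrow> 'l letter list" where
  "word_type k u = remdups_adj (filter (\<lambda>a. a \<notin> digits k) u)"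

text \<open>Words over \<open>[k]\<close> have no type.\<close>

definition has_type :: "nat \<Rightarrow> 'l letter list \<Rightarrow> 'l letter list \<Rightarrow> bool" where
  "has_type k u \<tau> \<longleftrightarrow> \<not> set u \<subseteq> digits k \<and> word_type k u = \<tau>"


section \<open>The numbers \<open>FK(k,q,d,r)\<close>\<close>

definition monochromatic :: "('a \<Rightarrow> nat) \<Rightarrow> 'a set \<Rightarrow> bool" where
  "monochromatic c A \<longleftrightarrow> (\<forall>u \<in> A. \<forall>v \<in> A. c u = c v)"

text \<open>A colouring is a total HOL function; only its values on \<open>cs_words k L W\<close> matter.\<close>

definition FK_property :: "'l itself \<Rightarrow> nat \<Rightarrow> nat \<Rightarrow> nat \<Rightarrow> nat \<Rightarrow> nat \<Rightarrow> bool" where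
  "FK_property _ k q d r N \<longleftrightarrow>
     (\<forall>n \<ge> N. \<forall>L :: 'l letter set. finite L \<longrightarrow> card L = q \<longrightarrow> L \<inter> digits k = {} \<longrightarrow> X \<notin> L \<longrightarrow>
       (\<forall>W c. carlson_simpson k n W \<longrightarrow> c ` cs_words k L W \<subseteq> {1..r} \<longrightarrow>
         (\<exists>V. cs_subsequence k d V W \<and>
           (\<forall>\<tau>. is_type L \<tau> \<longrightarrow>
             {u \<in> cs_words k L V. has_type k u \<tau>} = {} \<or>
             monochromatic c {u \<in> cs_words k L V. has_type k u \<tau>}))))"

definition FK :: "'l itself \<Rightarrow> nat \<Rightarrow> nat \<Rightarrow> nat \<Rightarrow> nat \<Rightarrow> nat" where
  "FK T k q d r = (LEAST N. 0 < N \<and> FK_property T k q d r N)"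


section \<open>Primitive recursive functions and the Grzegorczyk hierarchy\<close>

text \<open>
  A function \<open>\<nat>\<^sup>m \<rightarrow> \<nat>\<close> is represented by its values on the lists of length \<open>m\<close>; the rules \<open>ext\<close>
  close the classes under changing the values on other lists.
\<close>

inductive primitive_recursive :: "nat \<Rightarrow> (nat list \<Rightarrow> nat) \<Rightarrow> bool" where
  zero: "primitive_recursive m (\<lambda>_. 0)"
| succ: "primitive_recursive 1 (\<lambda>xs. Suc (xs ! 0))"
| proj: "i < m \<Longrightarrow> primitive_recursive m (\<lambda>xs. xs ! i)"
| comp: "\<lbrakk>primitive_recursive (length gs) f; \<forall>g \<in> set gs. primitive_recursive m g\<rbrakk>
    \<Longrightarrow> primitive_recursive m (\<lambda>xs. f (map (\<lambda>g. g xs) gs))"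
| prec: "\<lbrakk>primitive_recursive m g; primitive_recursive (Suc (Suc m)) h;
     \<forall>ys. length ys = m \<longrightarrow> f (0 # ys) = g ys;
     \<forall>t ys. length ys = m \<longrightarrow> f (Suc t # ys) = h (t # f (t # ys) # ys)\<rbrakk>
    \<Longrightarrow> primitive_recursive (Suc m) f"
| ext: "\<lbrakk>primitive_recursive m f; \<forall>xs. length xs = m \<longrightarrow> f' xs = f xs\<rbrakk>
    \<Longrightarrow> primitive_recursive m f'"

text \<open>
  The generating functions of the hierarchy are \<open>E\<^sub>0(x,y) = x + y\<close>, \<open>E\<^sub>1(x) = x\<^sup>2 + 2\<close>,
  \<open>E\<^sub>n\<^sub>+\<^sub>2(0) = 2\<close> and \<open>E\<^sub>n\<^sub>+\<^sub>2(x+1) = E\<^sub>n\<^sub>+\<^sub>1(E\<^sub>n\<^sub>+\<^sub>2(x))\<close>. Below, \<open>grz_E i\<close> is the unary function \<open>E\<^sub>i\<^sub>+\<^sub>1\<close>.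
\<close>

fun grz_E :: "nat \<Rightarrow> nat \<Rightarrow> nat" where
  "grz_E 0 x = x ^ 2 + 2"
| "grz_E (Suc i) 0 = 2"
| "grz_E (Suc i) (Suc x) = grz_E i (grz_E (Suc i) x)"

text \<open>
  \<open>grzegorczyk n m f\<close>: the function \<open>f\<close> of \<open>m\<close> variables belongs to \<open>\<E>\<^sup>n\<close>, the smallest class that
  contains the zero, successor and projection functions and \<open>E\<^sub>0, \<dots>, E\<^sub>n\<^sub>-\<^sub>1\<close> and is closed under
  composition and limited recursion.
\<close>

inductive grzegorczyk :: "nat \<Rightarrow> nat \<Rightarrow> (nat list \<Rightarrow> nat) \<Rightarrow> bool" for n :: nat where
  zero: "grzegorczyk n m (\<lambda>_. 0)"
| succ: "grzegorczyk n 1 (\<lambda>xs. Suc (xs ! 0))"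
| proj: "i < m \<Longrightarrow> grzegorczyk n m (\<lambda>xs. xs ! i)"
| E_zero: "0 < n \<Longrightarrow> grzegorczyk n 2 (\<lambda>xs. xs ! 0 + xs ! 1)"
| E_Suc: "Suc i < n \<Longrightarrow> grzegorczyk n 1 (\<lambda>xs. grz_E i (xs ! 0))"
| comp: "\<lbrakk>grzegorczyk n (length gs) f; \<forall>g \<in> set gs. grzegorczyk n m g\<rbrakk>
    \<Longrightarrow> grzegorczyk n m (\<lambda>xs. f (map (\<lambda>g. g xs) gs))"
| limited_rec: "\<lbrakk>grzegorczyk n m g; grzegorczyk n (Suc (Suc m)) h; grzegorczyk n (Suc m) b;
     \<forall>ys. length ys = m \<longrightarrow> f (0 # ys) = g ys;
     \<forall>t ys. length ys = m \<longrightarrow> f (Suc t # ys) = h (t # f (t # ys) # ys);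
     \<forall>t ys. length ys = m \<longrightarrow> f (t # ys) \<le> b (t # ys)\<rbrakk>
    \<Longrightarrow> grzegorczyk n (Suc m) f"
| ext: "\<lbrakk>grzegorczyk n m f; \<forall>xs. length xs = m \<longrightarrow> f' xs = f xs\<rbrakk>
    \<Longrightarrow> grzegorczyk n m f'"


section \<open>Independence of the universe of letters\<close>

definition good_ren :: "nat \<Rightarrow> 'a letter set \<Rightarrow> ('a letter \<Rightarrow> 'b letter) \<Rightarrow> bool" where
  "good_ren k L f \<longleftrightarrow> inj_on f (digits k \<union> L \<union> {X}) \<and> f X = X \<and> (\<forall>i \<in> {1..k}. f (Num i) = Num i)"

definition ren_seq :: "('a letter \<Rightarrow> 'b letter) \<Rightarrow> 'a cs_seq \<Rightarrow> 'b cs_seq" where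
  "ren_seq f W = (map f (fst W), map (map f) (snd W))"

lemma good_ren_X: "good_ren k L f \<Longrightarrow> b \<in> digits k \<union> L \<union> {X} \<Longrightarrow> f b = X \<longleftrightarrow> b = X"
  unfolding good_ren_def using inj_onD[of f "digits k \<union> L \<union> {X}" b X] by auto

lemma good_ren_digits: "good_ren k L f \<Longrightarrow> f ` digits k = digits k"
  unfolding good_ren_def digits_def image_image by (intro image_cong) simp_all

lemma good_ren_digits_iff:
  assumes "good_ren k L f" "b \<in> digits k \<union> L \<union> {X}"
  shows "f b \<in> digits k \<longleftrightarrow> b \<in> digits k"
proof
  assume "f b \<in> digits k"
  then obtain e where "e \<in> digits k" "f b = f e"
    using good_ren_digits[OF assms(1)] by (metis imageE)
  with assms show "b \<in> digits k"
    unfolding good_ren_def using inj_onD[of f "digits k \<union> L \<union> {X}" b e] by auto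
next
  assume "b \<in> digits k"
  then show "f b \<in> digits k" using good_ren_digits[OF assms(1)] by blast
qed

lemma subst_ren:
  assumes "good_ren k L f" "set u \<subseteq> digits k \<union> {X}"
  shows "map f (subst a u) = subst (f a) (map f u)"
  using assms(2) good_ren_X[OF assms(1)] by (auto simp: subst_def subset_iff)

lemma lvw_ren:
  assumes "good_ren k L f" "left_variable_word k u"
  shows "left_variable_word k (map f u)"
proof -
  have "f ` (digits k \<union> {X}) = digits k \<union> {X}"
    using good_ren_digits[OF assms(1)] assms(1) by (auto simp: good_ren_def)
  with assms show ?thesis
    unfolding left_variable_word_def by (auto simp: good_ren_def hd_map)
qed

lemma carlson_simpson_ren:
  assumes "good_ren k L f" "carlson_simpson k n W"
  shows "carlson_simpson k n (ren_seq f W)"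
  using assms lvw_ren[OF assms(1)] good_ren_digits[OF assms(1)]
  unfolding carlson_simpson_def ren_seq_def by auto

lemma concat_subst_ren:
  assumes g: "good_ren k L f" and W: "carlson_simpson k n W" and m: "\<forall>j \<in> set js. j < n"
  shows "map f (concat (map (\<lambda>j. subst (a j) (snd W ! j)) js))
       = concat (map (\<lambda>j. subst (f (a j)) (snd (ren_seq f W) ! j)) js)"
  using m
proof (induction js)
  case (Cons j js)
  have "j < length (snd W)" using Cons W by (simp add: carlson_simpson_def)
  moreover from this have "left_variable_word k (snd W ! j)"
    using W by (simp add: carlson_simpson_def)
  ultimately show ?case
    using Cons subst_ren[OF g, of "snd W ! j" "a j"]
    by (simp add: left_variable_word_def ren_seq_def)
qed simp

lemma cs_apply_ren:
  assumes g: "good_ren k L f" and W: "carlson_simpson k n W" and m: "length v \<le> n"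
  shows "map f (cs_apply W v) = cs_apply (ren_seq f W) (map f v)"
proof -
  have "concat (map (\<lambda>j. subst (f (v ! j)) (snd (ren_seq f W) ! j)) [0..<length v])
      = concat (map (\<lambda>j. subst (map f v ! j) (snd (ren_seq f W) ! j)) [0..<length v])"
    by (intro arg_cong[where f = concat] map_cong) auto
  then show ?thesis
    using concat_subst_ren[OF g W, of "[0..<length v]" "\<lambda>j. v ! j"] m
    unfolding cs_apply_def by (simp add: ren_seq_def)
qed

lemma cs_words_ren:
  assumes g: "good_ren k L f" and W: "carlson_simpson k n W" and u: "u \<in> cs_words k L W"
  shows "map f u \<in> cs_words k (f ` L) (ren_seq f W)"
proof -
  obtain v where v: "u = cs_apply W v" "set v \<subseteq> digits k \<union> L" "length v \<le> n"
    using u W by (auto simp: cs_words_def carlson_simpson_def)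
  have "set (map f v) \<subseteq> digits k \<union> f ` L"
    using v(2) good_ren_digits[OF g] by auto
  moreover have "length (map f v) \<le> length (snd (ren_seq f W))"
    using v(3) W by (simp add: ren_seq_def carlson_simpson_def)
  ultimately show ?thesis
    unfolding cs_words_def v(1) cs_apply_ren[OF g W v(3)] by blast
qed

lemma cs_words_letters:
  assumes W: "carlson_simpson k n W" and u: "u \<in> cs_words k L W"
  shows "set u \<subseteq> digits k \<union> L"
proof -
  obtain v where v: "u = cs_apply W v" "set v \<subseteq> digits k \<union> L" "length v \<le> n"
    using u W by (auto simp: cs_words_def carlson_simpson_def)
  have "set (subst (v ! j) (snd W ! j)) \<subseteq> digits k \<union> L" if "j < length v" for j
  proof -
    have "j < length (snd W)" using that v(3) W by (simp add: carlson_simpson_def)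
    then have "left_variable_word k (snd W ! j)" using W by (simp add: carlson_simpson_def)
    moreover have "v ! j \<in> digits k \<union> L" using that v(2) nth_mem by blast
    ultimately show ?thesis by (auto simp: subst_def left_variable_word_def)
  qed
  then show ?thesis
    using W unfolding v(1) cs_apply_def carlson_simpson_def by fastforce
qed

lemma cs_subsequence_ren:
  assumes g: "good_ren k L f" and W: "carlson_simpson k n W" and V: "cs_subsequence k d V W"
  shows "cs_subsequence k d (ren_seq f V) (ren_seq f W)"
proof -
  have n: "length (snd W) = n" using W by (simp add: carlson_simpson_def)
  have Vc: "carlson_simpson k d V" using V by (simp add: cs_subsequence_def)
  then have d: "length (snd V) = d" by (simp add: carlson_simpson_def)
  obtain a m where a: "\<forall>j < n. a j \<in> digits k \<union> {X}"
    and m: "\<forall>i < d. m i < m (Suc i)" "m d \<le> n"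
    and aX: "\<forall>i < d. a (m i) = X" and a0: "\<forall>j < m 0. a j \<in> digits k"
    and v: "fst V = fst W @ concat (map (\<lambda>j. subst (a j) (snd W ! j)) [0..<m 0])"
    and vi: "\<forall>i < d. snd V ! i = concat (map (\<lambda>j. subst (a j) (snd W ! j)) [m i..<m (Suc i)])"
    using V n unfolding cs_subsequence_def by auto
  have md: "m i \<le> m d" if "i \<le> d" for i
    using that
  proof (induction rule: inc_induct)
    case (step i)
    then show ?case using m(1) by (meson le_trans less_imp_le)
  qed simp
  have fd: "f b \<in> digits k" if "b \<in> digits k" for b using that good_ren_digits[OF g] by blast
  have fX: "f X = X" using g by (simp add: good_ren_def)
  have 1: "fst (ren_seq f V) = fst (ren_seq f W) @
      concat (map (\<lambda>j. subst ((f \<circ> a) j) (snd (ren_seq f W) ! j)) [0..<m 0])"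
    using concat_subst_ren[OF g W, of "[0..<m 0]" a] md[of 0] m(2) v
    by (simp add: ren_seq_def)
  have 2: "snd (ren_seq f V) ! i =
      concat (map (\<lambda>j. subst ((f \<circ> a) j) (snd (ren_seq f W) ! j)) [m i..<m (Suc i)])" if "i < d" for i
  proof -
    have "snd (ren_seq f V) ! i = map f (snd V ! i)" using that d by (simp add: ren_seq_def)
    also have "\<dots> = map f (concat (map (\<lambda>j. subst (a j) (snd W ! j)) [m i..<m (Suc i)]))"
      using vi that by simp
    also have "\<dots> = concat (map (\<lambda>j. subst (f (a j)) (snd (ren_seq f W) ! j)) [m i..<m (Suc i)])"
      using md[of "Suc i"] m(2) that by (intro concat_subst_ren[OF g W]) auto
    finally show ?thesis by simp
  qed
  show ?thesis
    unfolding cs_subsequence_def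
  proof (intro conjI exI[of _ "f \<circ> a"] exI[of _ m])
    show "carlson_simpson k d (ren_seq f V)" by (rule carlson_simpson_ren[OF g Vc])
    show "\<forall>j < length (snd (ren_seq f W)). (f \<circ> a) j \<in> digits k \<union> {X}"
      using a fd fX n by (auto simp: ren_seq_def)
    show "m d \<le> length (snd (ren_seq f W))" using m(2) n by (simp add: ren_seq_def)
    show "\<forall>i<d. (f \<circ> a) (m i) = X" using aX fX by simp
    show "\<forall>j<m 0. (f \<circ> a) j \<in> digits k" using a0 fd by simp
  qed (use m 1 2 in auto)
qed

lemma has_type_ren:
  assumes g: "good_ren k L f" and u: "set u \<subseteq> digits k \<union> L" and t: "has_type k u \<tau>"
  shows "has_type k (map f u) (map f \<tau>)"
proof -
  have i: "inj_on f (digits k \<union> L \<union> {X})" using g unfolding good_ren_def by blast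
  have "filter (\<lambda>a. a \<notin> digits k) (map f u) = map f (filter (\<lambda>a. a \<notin> digits k) u)"
    unfolding filter_map o_def
    by (intro arg_cong[where f = "map f"] filter_cong) (use u good_ren_digits_iff[OF g] in auto)
  moreover have "remdups_adj (map f ys) = map f (remdups_adj ys)"
    if "set ys \<subseteq> digits k \<union> L" for ys
    using that
  proof (induction ys rule: remdups_adj.induct)
    case (3 x y xs)
    have "f x = f y \<longleftrightarrow> x = y" using inj_onD[OF i, of x y] 3(3) by fastforce
    with 3 show ?case by simp
  qed auto
  moreover have "set (filter (\<lambda>a. a \<notin> digits k) u) \<subseteq> digits k \<union> L" using u by auto
  ultimately have "word_type k (map f u) = map f (word_type k u)"
    unfolding word_type_def by metis
  moreover have "\<not> set (map f u) \<subseteq> digits k"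
    using t u good_ren_digits_iff[OF g] unfolding has_type_def by fastforce
  ultimately show ?thesis using t by (simp add: has_type_def)
qed

lemma is_type_ren:
  assumes g: "good_ren k L f" and t: "is_type L \<tau>"
  shows "is_type (f ` L) (map f \<tau>)"
proof -
  have "inj_on f (set \<tau>)"
    using g t unfolding good_ren_def is_type_def by (meson inj_on_subset le_supI1 le_supI2)
  with t show ?thesis
    unfolding is_type_def by (auto simp: distinct_adj_map_iff distinct_adj_mapI)
qed

lemma FK_property_transfer:
  assumes B: "FK_property TYPE('b) k q d r N"
  shows "FK_property TYPE('a) k q d r N"
  unfolding FK_property_def
proof (intro allI impI)
  fix n and L :: "'a letter set" and W :: "'a cs_seq" and c :: "'a letter list \<Rightarrow> nat"
  assume n: "n \<ge> N" and L: "finite L" "card L = q" "L \<inter> digits k = {}" "X \<notin> L"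
    and W: "carlson_simpson k n W" and c: "c ` cs_words k L W \<subseteq> {1..r}"
  have "infinite (UNIV :: 'b letter set)"
    using finite_subset[OF subset_UNIV, of "range (Num :: nat \<Rightarrow> 'b letter)"]
    by (auto simp: finite_image_iff inj_on_def)
  then have "infinite (UNIV - (digits k \<union> {X}) :: 'b letter set)"
    by (intro Diff_infinite_finite) (auto simp: digits_def)
  then obtain L' :: "'b letter set" where L': "finite L'" "card L' = q"
    "L' \<subseteq> UNIV - (digits k \<union> {X})"
    using infinite_arbitrarily_large by blast
  obtain h where h: "bij_betw h L L'" using finite_same_card_bij L L' by metis
  define f :: "'a letter \<Rightarrow> 'b letter" where
    "f b = (if b \<in> L then h b else case b of Num i \<Rightarrow> Num i | _ \<Rightarrow> X)" for b
  let ?A = "digits k \<union> L \<union> {X}"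
  have fL: "f ` L = L'" using h by (auto simp: f_def bij_betw_def)
  have fN: "f (Num i) = Num i" if "i \<in> {1..k}" for i
    using that L(3) by (auto simp: f_def digits_def)
  have fX: "f X = X" using L(4) by (simp add: f_def)
  have "inj_on f ?A"
  proof (rule inj_onI)
    fix y z assume yz: "y \<in> ?A" "z \<in> ?A" and e: "f y = f z"
    have l: "f b \<in> L'" if "b \<in> L" for b using that fL by blast
    have o: "f b \<in> digits k \<union> {X}" "(b = Num i) = (f b = Num i)" if "b \<in> ?A" "b \<notin> L" for b i
      using that fN fX by (auto simp: digits_def)
    have D: "x \<notin> digits k \<union> {X}" if "x \<in> L'" for x using that L'(3) by blast
    consider "y \<in> L" "z \<in> L" | "y \<in> L" "z \<notin> L" | "y \<notin> L" "z \<in> L" | "y \<notin> L" "z \<notin> L" by blast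
    then show "y = z"
    proof cases
      case 1
      then show ?thesis using e h by (auto simp: f_def bij_betw_def inj_on_def)
    next
      case 2
      then show ?thesis using l[of y] o(1)[of z] D e yz by metis
    next
      case 3
      then show ?thesis using l[of z] o(1)[of y] D e yz by metis
    next
      case 4
      then show ?thesis using e yz fN fX by (auto simp: digits_def)
    qed
  qed
  then have g: "good_ren k L f" using fN fX by (auto simp: good_ren_def)
  define s where "s = inv_into ?A f"
  have sf: "s (f b) = b" if "b \<in> ?A" for b
    using that \<open>inj_on f ?A\<close> by (simp add: s_def)
  have A': "f ` ?A = digits k \<union> L' \<union> {X}"
    using good_ren_digits[OF g] fL fX by (simp add: image_Un)
  have fs: "f (s b) = b" if "b \<in> digits k \<union> L' \<union> {X}" for b
    using that A' by (simp add: s_def f_inv_into_f)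
  have sL: "s ` L' = L" using sf by (force simp: fL[symmetric] image_image)
  have gs: "good_ren k L' s"
    unfolding good_ren_def
  proof (intro conjI ballI)
    show "inj_on s (digits k \<union> L' \<union> {X})" by (metis fs inj_onI)
    show "s X = X" using sf[of X] fX by simp
    fix i assume "i \<in> {1..k}"
    then show "s (Num i) = Num i" using sf[of "Num i"] fN[of i] by (auto simp: digits_def)
  qed
  have id: "map s (map f u) = u" if "set u \<subseteq> ?A" for u
    using that sf by (auto intro!: map_idI)
  let ?W = "ren_seq f W"
  have W': "carlson_simpson k n ?W" by (rule carlson_simpson_ren[OF g W])
  have seq_id: "ren_seq s ?W = W"
  proof -
    have "map s (map f (fst W)) = fst W"
      using W by (intro id) (auto simp: carlson_simpson_def)
    moreover have "map s (map f u) = u" if "u \<in> set (snd W)" for u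
      using W that by (intro id) (auto simp: carlson_simpson_def left_variable_word_def)
    then have "map (map s) (map (map f) (snd W)) = snd W"
      by (simp add: map_idI)
    ultimately show ?thesis unfolding ren_seq_def by (metis fst_conv snd_conv surjective_pairing)
  qed
  have "(c \<circ> map s) ` cs_words k L' ?W \<subseteq> {1..r}"
  proof -
    have "map s u \<in> cs_words k L W" if "u \<in> cs_words k L' ?W" for u
      using cs_words_ren[OF gs W' that] by (simp add: sL seq_id)
    with c show ?thesis by auto
  qed
  moreover have "L' \<inter> digits k = {}" "X \<notin> L'" using L'(3) by auto
  ultimately obtain V where V: "cs_subsequence k d V ?W"
    and mono: "\<forall>\<tau>. is_type L' \<tau> \<longrightarrow>
             {u \<in> cs_words k L' V. has_type k u \<tau>} = {} \<or>
             monochromatic (c \<circ> map s) {u \<in> cs_words k L' V. has_type k u \<tau>}"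
    using B[unfolded FK_property_def, rule_format, OF n L'(1,2) _ _ W', of "c \<circ> map s"] by blast
  have Vc: "carlson_simpson k d V" using V by (simp add: cs_subsequence_def)
  let ?V = "ren_seq s V"
  have V': "cs_subsequence k d ?V W"
    using cs_subsequence_ren[OF gs W' V] by (simp add: seq_id)
  have Vc': "carlson_simpson k d ?V" using V' by (simp add: cs_subsequence_def)
  have "ren_seq f ?V = V"
  proof -
    have id': "map f (map s u) = u" if "set u \<subseteq> digits k \<union> L' \<union> {X}" for u
      using that fs by (auto intro!: map_idI)
    have "map f (map s (fst V)) = fst V"
      using Vc by (intro id') (auto simp: carlson_simpson_def)
    moreover have "map f (map s u) = u" if "u \<in> set (snd V)" for u
      using Vc that by (intro id') (auto simp: carlson_simpson_def left_variable_word_def)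
    then have "map (map f) (map (map s) (snd V)) = snd V"
      by (simp add: map_idI)
    ultimately show ?thesis unfolding ren_seq_def by (metis fst_conv snd_conv surjective_pairing)
  qed
  then have up: "map f u \<in> cs_words k L' V" if "u \<in> cs_words k L ?V" for u
    using cs_words_ren[OF g Vc' that] by (simp add: fL)
  show "\<exists>V. cs_subsequence k d V W \<and>
           (\<forall>\<tau>. is_type L \<tau> \<longrightarrow>
             {u \<in> cs_words k L V. has_type k u \<tau>} = {} \<or>
             monochromatic c {u \<in> cs_words k L V. has_type k u \<tau>})"
  proof (intro exI conjI allI impI disjI2)
    show "cs_subsequence k d ?V W" by (rule V')
    fix \<tau> assume t: "is_type L \<tau>"
    have t': "is_type L' (map f \<tau>)" using is_type_ren[OF g t] by (simp add: fL)
    show "monochromatic c {u \<in> cs_words k L ?V. has_type k u \<tau>}"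
      unfolding monochromatic_def
    proof (intro ballI)
      fix u v
      assume u: "u \<in> {u \<in> cs_words k L ?V. has_type k u \<tau>}"
        and v: "v \<in> {u \<in> cs_words k L ?V. has_type k u \<tau>}"
      have *: "map f u \<in> {u \<in> cs_words k L' V. has_type k u (map f \<tau>)} \<and> map s (map f u) = u"
        if "u \<in> {u \<in> cs_words k L ?V. has_type k u \<tau>}" for u
      proof -
        have "set u \<subseteq> digits k \<union> L" using that cs_words_letters[OF Vc'] by blast
        then show ?thesis using that up has_type_ren[OF g, of u \<tau>] id[of u] by blast
      qed
      have "(c \<circ> map s) (map f u) = (c \<circ> map s) (map f v)"
        using mono t' *[OF u] *[OF v] unfolding monochromatic_def by blast
      then show "c u = c v" using *[OF u] *[OF v] by (simp del: map_map)
    qed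
  qed
qed

lemma FK_universe_independent: "FK TYPE('a) k q d r = FK TYPE('b) k q d r"
  unfolding FK_def
  using FK_property_transfer[where 'a = 'a and 'b = 'b] FK_property_transfer[where 'a = 'b and 'b = 'a]
  by (intro arg_cong[where f = Least] ext) blast

end

theory Submission
  imports Defs "HOL-Library.Sublist" "HOL-Library.FuncSet"
begin

text \<open>
  Shelah's pigeonhole argument makes a colouring insensitive to replacing one digit by another, at
  the cost of a tower function for each pair of digits, so that after \<open>k - 1\<close> steps all digits
  behave alike. Then a word is given by the blocks of positions that carry the letters of its
  successive runs together with its length, and the theorem follows from a finite
  Milliken--Taylor theorem for increasing sequences of blocks. The latter is obtained by making the
  colour of a tuple independent of its last block, which needs iterations of the finite unions
  theorem, and by induction on the length of the tuples. The finite unions theorem for increasing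
  blocks reduces by Ramsey's theorem to Folkman's theorem on sums of integers, where the
  Kovari--Sos--Turan argument keeps the bound a tower function, that is, below an iterate of
  \<open>grz_E 2\<close>; the two iterations on top of it give \<open>grz_E 4\<close>.
\<close>

section \<open>Iterates of the generating functions\<close>

text \<open>The count of levels shapes the proof. \<open>grz_E 4\<close> is the last generator of
  the class of order 6, so the final bound may apply it a fixed number of times. An iteration whose
  length is an input raises the level by one, and \<open>tuple_bound\<close> nests two of them, so
  the finite unions theorem must stay at \<open>grz_E 2\<close>. Ramsey's theorem reaches that level
  by the same two iterations, starting from the product \<open>r * m\<close> at level 0, and
  Folkman's theorem by one iteration of a box bound at level 1. Nesting k - 1 towers to identify the
  digits takes \<open>grz_E 3\<close>. The given sequence \<open>W\<close> is arbitrary and its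
  words carry the colouring. All constructions are therefore made for colourings of words over the
  alphabet itself: a colouring is pulled back along \<open>cs_apply W\<close>, and the sequence
  found is moved into \<open>W\<close> by composition, which yields a subsequence and preserves
  types.\<close>

definition E_iter :: "nat \<Rightarrow> nat \<Rightarrow> nat \<Rightarrow> nat" where
  "E_iter i c x = (grz_E i ^^ c) x"

lemma less_grz_E: "x < grz_E i x"
proof (induction i arbitrary: x)
  case 0
  have "x \<le> x ^ 2" by (cases x) (auto simp: power2_eq_square)
  then show ?case by simp
next
  case (Suc i)
  show ?case
  proof (induction x)
    case (Suc x)
    then show ?case using \<open>\<And>x. x < grz_E i x\<close>[of "grz_E (Suc i) x"] by simp
  qed simp
qed

lemma mono_grz_E: "mono (grz_E i)"
proof (cases i)
  case 0
  then show ?thesis by (auto intro!: monoI power_mono)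
next
  case (Suc j)
  then show ?thesis using less_grz_E[of "grz_E i x" j for x] by (auto simp: mono_iff_le_Suc less_imp_le)
qed

lemma grz_E_le_Suc: "grz_E i x \<le> grz_E (Suc i) x"
proof (cases x)
  case 0
  then show ?thesis by (cases i) auto
next
  case (Suc y)
  have "x \<le> grz_E (Suc i) y" using less_grz_E[of y "Suc i"] Suc by simp
  then show ?thesis using Suc monoD[OF mono_grz_E] by simp
qed

lemma grz_E_mono_index: "i \<le> j \<Longrightarrow> grz_E i x \<le> grz_E j x"
  by (rule lift_Suc_mono_le[of "\<lambda>i. grz_E i x"]) (use grz_E_le_Suc in auto)

lemma E_iter_0 [simp]: "E_iter i 0 x = x"
  and E_iter_Suc: "E_iter i (Suc c) x = grz_E i (E_iter i c x)"
  and E_iter_add: "E_iter i (c + c') x = E_iter i c (E_iter i c' x)"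
  by (simp_all add: E_iter_def funpow_add)

lemma E_iter_mono: "x \<le> y \<Longrightarrow> E_iter i c x \<le> E_iter i c y"
  by (induction c) (auto simp: E_iter_Suc intro: monoD[OF mono_grz_E])

lemma le_E_iter: "x + c \<le> E_iter i c x"
proof (induction c)
  case (Suc c)
  then show ?case using less_grz_E[of "E_iter i c x" i] by (simp add: E_iter_Suc)
qed simp

lemma E_iter_mono_count: "c \<le> c' \<Longrightarrow> E_iter i c x \<le> E_iter i c' x"
  using le_E_iter[of "E_iter i c x" "c' - c" i] E_iter_add[of i "c' - c" c x] by simp

lemma E_iter_mono_index: "i \<le> j \<Longrightarrow> E_iter i c x \<le> E_iter j c x"
proof (induction c)
  case (Suc c)
  then show ?case
    unfolding E_iter_Suc by (meson grz_E_mono_index le_trans monoD mono_grz_E)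
qed simp

lemma grz_E_Suc_eq: "grz_E (Suc i) n = E_iter i n 2"
  by (induction n) (auto simp: E_iter_Suc)

lemma E_iter_le_grz_E_Suc: "E_iter i n x \<le> grz_E (Suc i) (n + x)"
  using E_iter_mono[of x "E_iter i x 2" i n] le_E_iter[of 2 x i]
  by (simp add: grz_E_Suc_eq E_iter_add)

lemma square_le_grz_E: "x * x + 2 \<le> grz_E i x"
  using grz_E_mono_index[of 0 i x] by (simp add: power2_eq_square)

lemma two_power_le_grz_E: "2 ^ (2 ^ x) \<le> grz_E (Suc i) x"
proof -
  have "2 ^ (2 ^ x) \<le> grz_E (Suc 0) x"
  proof (induction x)
    case (Suc x)
    have "(2::nat) ^ (2 ^ Suc x) = (2 ^ (2 ^ x)) ^ 2" by (simp add: power_mult[symmetric] mult.commute)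
    also have "\<dots> \<le> (grz_E (Suc 0) x) ^ 2" using Suc by (intro power_mono) auto
    finally show ?case by simp
  qed simp
  then show ?thesis using grz_E_mono_index[of "Suc 0" "Suc i" x] by linarith
qed

text \<open>These rules serve goals \<open>t \<le> E_iter i ?c x\<close> with an open count: each
  computes a count for an expression from counts for its parts, so a growth estimate is found by
  following the term.\<close>

lemma E_iter_leI_arg: "a \<le> x \<Longrightarrow> a \<le> E_iter i 0 x"
  by simp

lemma E_iter_leI_const: "a \<le> E_iter i a x"
  using le_E_iter[of x a i] by linarith

lemma E_iter_leI_index: "a \<le> E_iter i c x \<Longrightarrow> i \<le> j \<Longrightarrow> a \<le> E_iter j c x"
  using E_iter_mono_index le_trans by blast

lemma E_iter_leI_comp: "a \<le> E_iter i c y \<Longrightarrow> y \<le> E_iter i c' x \<Longrightarrow> a \<le> E_iter i (c + c') x"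
  using E_iter_mono[of y "E_iter i c' x" i c] by (simp add: E_iter_add)

text \<open>One application of any \<open>grz_E i\<close> exceeds y * y + 2, which covers the
  product and also y + y; the summand 2 takes care of small y.\<close>

lemma E_iter_leI_double:
  assumes "a \<le> E_iter i c x" "b \<le> E_iter i c x"
  shows "a + b \<le> E_iter i (Suc c) x" "a * b \<le> E_iter i (Suc c) x"
proof -
  let ?y = "E_iter i c x"
  have double: "y + y \<le> y * y + 2" for y :: nat
    using mult_right_mono[of 2 y y] by (cases "y < 2") (auto simp: less_Suc_eq numeral_2_eq_2)
  show "a + b \<le> E_iter i (Suc c) x"
    using assms double[of ?y] square_le_grz_E[of ?y i] unfolding E_iter_Suc by linarith
  show "a * b \<le> E_iter i (Suc c) x"
    using mult_mono[OF assms] square_le_grz_E[of ?y i] unfolding E_iter_Suc by linarith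
qed

lemma E_iter_leI_add_mult:
  assumes "a \<le> E_iter i c x" "b \<le> E_iter i c' x"
  shows "a + b \<le> E_iter i (Suc (c + c')) x" "a * b \<le> E_iter i (Suc (c + c')) x"
proof -
  have "a \<le> E_iter i (c + c') x" "b \<le> E_iter i (c + c') x"
    using assms E_iter_mono_count[of c "c + c'" i x] E_iter_mono_count[of c' "c + c'" i x]
    by linarith+
  then show "a + b \<le> E_iter i (Suc (c + c')) x" "a * b \<le> E_iter i (Suc (c + c')) x"
    by (rule E_iter_leI_double)+
qed

lemma E_iter_leI_Suc: "a \<le> E_iter i c x \<Longrightarrow> Suc a \<le> E_iter i (Suc c) x"
  using less_grz_E[of "E_iter i c x" i] by (simp add: E_iter_Suc)

text \<open>a ^ b \<le> 2 ^ (a * b), and from level 1 on the generators dominate a double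
  exponential.\<close>

lemma E_iter_leI_power:
  assumes "1 \<le> i" "a \<le> E_iter i c x" "b \<le> E_iter i c' x"
  shows "a ^ b \<le> E_iter i (Suc (Suc (c + c'))) x"
proof -
  let ?y = "a * b"
  have "a ^ b \<le> (2 ^ a) ^ b" by (rule power_mono[OF less_imp_le[OF less_exp]]) simp
  also have "\<dots> = 2 ^ ?y" by (simp add: power_mult)
  also have "\<dots> \<le> 2 ^ (2 ^ ?y)" by (rule power_increasing[OF less_imp_le[OF less_exp]]) simp
  also have "\<dots> \<le> grz_E i ?y" using two_power_le_grz_E[of ?y "i - 1"] assms(1) by simp
  also have "\<dots> \<le> grz_E i (E_iter i (Suc (c + c')) x)"
    using E_iter_leI_add_mult(2)[OF assms(2,3)] by (rule monoD[OF mono_grz_E])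
  finally show ?thesis by (simp add: E_iter_Suc)
qed

lemmas E_iter_leIs = E_iter_leI_power E_iter_leI_add_mult E_iter_leI_Suc
  E_iter_leI_const[of 1] E_iter_leI_const[of "numeral n" for n]

text \<open>A step of a fixed number of applications of \<open>grz_E i\<close>, made n times, is a
  number of applications linear in n, which \<open>grz_E (Suc i)\<close> performs at once. The
  summand \<open>a\<close> carries the parameters on which every step depends.\<close>

lemma iterate_le_grz_E:
  assumes step: "\<And>t. t < n \<Longrightarrow> y (Suc t) \<le> E_iter i c (a + y t)"
  shows "a + y n \<le> grz_E (Suc i) (Suc (Suc c) * n + a + y 0)"
proof -
  have "a + y n \<le> E_iter i (Suc (Suc c) * n) (a + y 0)"
    using step
  proof (induction n)
    case (Suc n)
    let ?x = "a + y n"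
    have "a + y (Suc n) \<le> E_iter i (Suc (0 + c)) ?x"
      using Suc.prems by (intro E_iter_leI_add_mult) auto
    also have "\<dots> \<le> E_iter i (Suc (Suc c)) ?x" by (intro E_iter_mono_count) simp
    also have "\<dots> \<le> E_iter i (Suc (Suc c)) (E_iter i (Suc (Suc c) * n) (a + y 0))"
      using Suc by (intro E_iter_mono) simp
    finally show ?case by (simp only: E_iter_add[symmetric] mult_Suc_right)
  qed simp
  also have "\<dots> \<le> grz_E (Suc i) (Suc (Suc c) * n + (a + y 0))" by (rule E_iter_le_grz_E_Suc)
  finally show ?thesis by (simp add: add.assoc)
qed

section \<open>Colourings of tuples\<close>

text \<open>Packs the colours in all contexts \<open>x \<in> S\<close> into one number, so that a
  single pigeonhole step makes all of them constant.\<close>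

lemma vector_code:
  fixes S :: "'x set" and r :: nat
  assumes "finite S" "card S \<le> N" "0 < r"
  obtains e :: "('x \<Rightarrow> nat) \<Rightarrow> nat" where
    "\<And>h. (\<And>x. h x < r) \<Longrightarrow> e h < r ^ N"
    "\<And>h h' x. (\<And>x. h x < r) \<Longrightarrow> (\<And>x. h' x < r) \<Longrightarrow> e h = e h' \<Longrightarrow> x \<in> S \<Longrightarrow> h x = h' x"
proof -
  let ?F = "PiE S (\<lambda>_. {..<r})"
  have fin: "finite ?F" using assms(1) by (intro finite_PiE) auto
  obtain e where e: "bij_betw e ?F {..<card ?F}"
    using ex_bij_betw_finite_nat[OF fin] by (auto simp: atLeast0LessThan)
  have card: "card ?F \<le> r ^ N"
    using assms by (simp add: card_PiE power_increasing)
  have F: "restrict h S \<in> ?F" if "\<And>x. h x < r" for h using that by auto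
  show ?thesis
  proof (rule that[of "\<lambda>h. e (restrict h S)"])
    show "e (restrict h S) < r ^ N" if "\<And>x. h x < r" for h
    proof -
      have "e (restrict h S) \<in> {..<card ?F}" using bij_betwE[OF e] F[of h, OF that] by blast
      then show ?thesis using card by simp
    qed
    show "h x = h' x" if "\<And>x. h x < r" "\<And>x. h' x < r" "e (restrict h S) = e (restrict h' S)" "x \<in> S"
      for h h' x
    proof -
      have "restrict h S = restrict h' S"
        using inj_onD[OF bij_betw_imp_inj_on[OF e], of "restrict h S" "restrict h' S"] that(3)
          F[of h, OF that(1)] F[of h', OF that(2)]
        by blast
      then show ?thesis using that(4) by (auto dest!: fun_cong[of _ _ x])
    qed
  qed
qed

text \<open>\<open>j\<close> counts the terms fixed so far. They have at most 3 ^ j refinements, and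
  a new term is coloured by a vector with one entry for each of these; the \<open>Suc\<close> is the
  term that gets fixed next.\<close>

fun end_bound :: "(nat \<Rightarrow> nat \<Rightarrow> nat) \<Rightarrow> nat \<Rightarrow> nat \<Rightarrow> nat \<Rightarrow> nat" where
  "end_bound h 0 j r = 0"
| "end_bound h (Suc m) j r = h (Suc (end_bound h m (Suc j) r)) (r ^ (3 ^ j))"

fun tuple_bound :: "(nat \<Rightarrow> nat \<Rightarrow> nat) \<Rightarrow> nat \<Rightarrow> nat \<Rightarrow> nat \<Rightarrow> nat" where
  "tuple_bound h 0 m r = m"
| "tuple_bound h (Suc s) m r = end_bound h (Suc (tuple_bound h s m (r * r))) 0 r"

text \<open>
  \<open>D \<sqsubseteq> E\<close> says that the sequence \<open>D\<close> is obtained from the sequence \<open>E\<close>, and \<open>h m r\<close> bounds the length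
  that forces one of length \<open>m\<close> whose one-term refinements all have the same colour. Both
  Ramsey's theorem (\<open>D\<close> is a subsequence of \<open>E\<close>) and the finite Milliken--Taylor theorem (the terms
  of \<open>D\<close> are unions of terms of \<open>E\<close>) are instances of the result on tuples.
\<close>

locale refinement =
  fixes refines :: "'a list \<Rightarrow> 'a list \<Rightarrow> bool" (infix "\<sqsubseteq>" 50)
    and h :: "nat \<Rightarrow> nat \<Rightarrow> nat"
  assumes refl: "D \<sqsubseteq> D"
    and trans: "D \<sqsubseteq> E \<Longrightarrow> E \<sqsubseteq> F \<Longrightarrow> D \<sqsubseteq> F"
    and append: "D \<sqsubseteq> F \<Longrightarrow> E \<sqsubseteq> G \<Longrightarrow> D @ E \<sqsubseteq> F @ G"
    and Nil_refines: "[] \<sqsubseteq> D"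
    and split: "P @ [b] \<sqsubseteq> D \<Longrightarrow> \<exists>F G. D = F @ G \<and> P \<sqsubseteq> F \<and> [b] \<sqsubseteq> G"
    and not_refines_Nil: "\<not> [b] \<sqsubseteq> []"
    and finite_refinements: "finite {P. P \<sqsubseteq> D}"
    and card_refinements: "card {P. P \<sqsubseteq> D} \<le> 3 ^ length D"
    and pigeonhole: "\<lbrakk>h m r \<le> length D; \<And>b. f b < r\<rbrakk> \<Longrightarrow>
      \<exists>E. E \<sqsubseteq> D \<and> length E = m \<and> (\<forall>b b'. [b] \<sqsubseteq> E \<longrightarrow> [b'] \<sqsubseteq> E \<longrightarrow> f b = (f b' :: nat))"
begin

lemma append_left: "D \<sqsubseteq> F \<Longrightarrow> D \<sqsubseteq> K @ F"
  using append[OF Nil_refines, of D F K] by simp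

lemma append_right: "D \<sqsubseteq> F \<Longrightarrow> D \<sqsubseteq> F @ K"
  using append[OF _ Nil_refines, of D F K] by simp

lemma Cons: "D \<sqsubseteq> F \<Longrightarrow> x # D \<sqsubseteq> x # F"
  using append[OF refl, of D F "[x]"] by simp

text \<open>\<open>F\<close> holds the terms already chosen and \<open>R\<close> is the reservoir.
  The reservoir is made homogeneous for the vector of all f (P @ [b]) with P \<sqsubseteq> F; then
  its first term joins \<open>F\<close> and the rest is the new reservoir.\<close>

lemma end_homogeneous_aux:
  fixes f :: "'a list \<Rightarrow> nat"
  assumes f: "\<And>P. f P < r" and len: "end_bound h m (length F) r \<le> length R"
  shows "\<exists>G. G \<sqsubseteq> R \<and> length G = m \<and>
    (\<forall>G\<^sub>1 G\<^sub>2 P b b'. G = G\<^sub>1 @ G\<^sub>2 \<longrightarrow> P \<sqsubseteq> F @ G\<^sub>1 \<longrightarrow> [b] \<sqsubseteq> G\<^sub>2 \<longrightarrow> [b'] \<sqsubseteq> G\<^sub>2 \<longrightarrow>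
      f (P @ [b]) = f (P @ [b']))"
  using len
proof (induction m arbitrary: F R)
  case 0
  show ?case by (rule exI[of _ "[]"]) (use Nil_refines not_refines_Nil in auto)
next
  case (Suc m)
  let ?S = "{P. P \<sqsubseteq> F}"
  have "0 < r" using f[of "[]"] by simp
  obtain e where e: "\<And>g. (\<And>x. g x < r) \<Longrightarrow> e g < r ^ (3 ^ length F)"
    "\<And>g g' x. (\<And>x. g x < r) \<Longrightarrow> (\<And>x. g' x < r) \<Longrightarrow> e g = e g' \<Longrightarrow> x \<in> ?S \<Longrightarrow> g x = g' x"
    using vector_code[OF finite_refinements card_refinements \<open>0 < r\<close>] by blast
  have "h (Suc (end_bound h m (Suc (length F)) r)) (r ^ (3 ^ length F)) \<le> length R"
    using Suc.prems by simp
  from pigeonhole[OF this, of "\<lambda>b. e (\<lambda>P. f (P @ [b]))"] obtain R' where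
    R': "R' \<sqsubseteq> R" "length R' = Suc (end_bound h m (Suc (length F)) r)" and
    col: "\<And>b b'. [b] \<sqsubseteq> R' \<Longrightarrow> [b'] \<sqsubseteq> R' \<Longrightarrow> e (\<lambda>P. f (P @ [b])) = e (\<lambda>P. f (P @ [b']))"
    using e(1)[OF f] by auto
  obtain x R'' where R'': "R' = x # R''" "length R'' = end_bound h m (length (F @ [x])) r"
    using R'(2) by (cases R') auto
  obtain G where G: "G \<sqsubseteq> R''" "length G = m" and
    hom: "\<And>G\<^sub>1 G\<^sub>2 P b b'. G = G\<^sub>1 @ G\<^sub>2 \<Longrightarrow> P \<sqsubseteq> (F @ [x]) @ G\<^sub>1 \<Longrightarrow> [b] \<sqsubseteq> G\<^sub>2 \<Longrightarrow> [b'] \<sqsubseteq> G\<^sub>2 \<Longrightarrow>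
      f (P @ [b]) = f (P @ [b'])"
    using Suc.IH[of "F @ [x]" R'', OF eq_refl[OF R''(2)[symmetric]]] by blast
  have GR': "x # G \<sqsubseteq> R'" using Cons[OF G(1)] R''(1) by simp
  show ?case
  proof (intro exI[of _ "x # G"] conjI allI impI)
    show "x # G \<sqsubseteq> R" using trans[OF GR' R'(1)] .
    show "length (x # G) = Suc m" using G by simp
    fix G\<^sub>1 G\<^sub>2 P b b'
    assume *: "x # G = G\<^sub>1 @ G\<^sub>2" "P \<sqsubseteq> F @ G\<^sub>1" "[b] \<sqsubseteq> G\<^sub>2" "[b'] \<sqsubseteq> G\<^sub>2"
    show "f (P @ [b]) = f (P @ [b'])"
    proof (cases G\<^sub>1)
      case Nil
      then have "[b] \<sqsubseteq> R'" "[b'] \<sqsubseteq> R'" using * trans[OF _ GR'] by auto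
      from e(2)[OF f f col[OF this], of P] show ?thesis using * Nil by simp
    next
      case (Cons y G\<^sub>1')
      then show ?thesis using * by (intro hom[of G\<^sub>1' G\<^sub>2 P]) auto
    qed
  qed
qed

lemma end_homogeneous:
  fixes f :: "'a list \<Rightarrow> nat"
  assumes f: "\<And>P. f P < r" and len: "end_bound h m 0 r \<le> length D"
  obtains G where "G \<sqsubseteq> D" "length G = m"
    "\<And>P b b'. P @ [b] \<sqsubseteq> G \<Longrightarrow> P @ [b'] \<sqsubseteq> G \<Longrightarrow> f (P @ [b]) = f (P @ [b'])"
proof -
  obtain G where G: "G \<sqsubseteq> D" "length G = m" and
    hom: "\<And>G\<^sub>1 G\<^sub>2 P b b'. G = G\<^sub>1 @ G\<^sub>2 \<Longrightarrow> P \<sqsubseteq> G\<^sub>1 \<Longrightarrow> [b] \<sqsubseteq> G\<^sub>2 \<Longrightarrow> [b'] \<sqsubseteq> G\<^sub>2 \<Longrightarrow>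
      f (P @ [b]) = f (P @ [b'])"
    using end_homogeneous_aux[of f r m "[]" D, OF f, unfolded append_Nil list.size(3), OF len]
    by blast
  show ?thesis
  proof (rule that[OF G])
    fix P b b'
    assume "P @ [b] \<sqsubseteq> G" "P @ [b'] \<sqsubseteq> G"
    then obtain G\<^sub>1 G\<^sub>2 H\<^sub>1 H\<^sub>2 where *: "G = G\<^sub>1 @ G\<^sub>2" "P \<sqsubseteq> G\<^sub>1" "[b] \<sqsubseteq> G\<^sub>2"
      "G = H\<^sub>1 @ H\<^sub>2" "P \<sqsubseteq> H\<^sub>1" "[b'] \<sqsubseteq> H\<^sub>2"
      using split[of P b G] split[of P b' G] by blast
    \<comment> \<open>Of the two cuts of \<open>G\<close> the earlier one serves both tuples,
      because its right part contains the right part of the other.\<close>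
    then obtain K where "G\<^sub>1 = H\<^sub>1 @ K \<and> H\<^sub>2 = K @ G\<^sub>2 \<or> H\<^sub>1 = G\<^sub>1 @ K \<and> G\<^sub>2 = K @ H\<^sub>2"
      by (metis append_eq_append_conv2)
    then show "f (P @ [b]) = f (P @ [b'])"
      using hom[of G\<^sub>1 G\<^sub>2 P b b'] hom[of H\<^sub>1 H\<^sub>2 P b b'] * append_left[of "[b]" G\<^sub>2] append_left[of "[b']" H\<^sub>2] by blast
  qed
qed

text \<open>By end-homogeneity the last term of a tuple may be replaced by a reserved term
  \<open>z\<close>. The colour of a tuple of length s + 1 then is a colour of its first s terms, to
  which the induction hypothesis applies.\<close>

theorem tuples:
  fixes f :: "'a list \<Rightarrow> nat"
  assumes "\<And>P. f P < r" "tuple_bound h s m r \<le> length D"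
  shows "\<exists>E. E \<sqsubseteq> D \<and> length E = m \<and>
    (\<forall>P Q. P \<sqsubseteq> E \<longrightarrow> Q \<sqsubseteq> E \<longrightarrow> length P = length Q \<longrightarrow> length P \<le> s \<longrightarrow> f P = f Q)"
  using assms
proof (induction s arbitrary: f r D)
  case 0
  have "take m D \<sqsubseteq> D" using append_right[OF refl, of "take m D" "drop m D"] by simp
  then show ?case using 0 by (intro exI[of _ "take m D"]) auto
next
  case (Suc s)
  obtain G where G: "G \<sqsubseteq> D" "length G = Suc (tuple_bound h s m (r * r))" and
    hom: "\<And>P b b'. P @ [b] \<sqsubseteq> G \<Longrightarrow> P @ [b'] \<sqsubseteq> G \<Longrightarrow> f (P @ [b]) = f (P @ [b'])"
    using end_homogeneous[of f r "Suc (tuple_bound h s m (r * r))" D] Suc.prems by auto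
  obtain G' z where z: "G = G' @ [z]" "length G' = tuple_bound h s m (r * r)"
    using G(2) by (cases G rule: rev_cases) auto
  \<comment> \<open>Two colours as digits in base \<open>r\<close>; division by \<open>r\<close>
    recovers f (P @ [z]).\<close>
  let ?g = "\<lambda>P. f (P @ [z]) * r + f P"
  have g: "?g P < r * r" for P
  proof -
    have "?g P < Suc (f (P @ [z])) * r" using Suc.prems(1)[of P] by simp
    also have "\<dots> \<le> r * r" using Suc.prems(1)[of "P @ [z]"] by (intro mult_right_mono) auto
    finally show ?thesis .
  qed
  obtain E where E: "E \<sqsubseteq> G'" "length E = m" and
    mono: "\<And>P Q. P \<sqsubseteq> E \<Longrightarrow> Q \<sqsubseteq> E \<Longrightarrow> length P = length Q \<Longrightarrow> length P \<le> s \<Longrightarrow> ?g P = ?g Q"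
    using Suc.IH[of ?g "r * r" G', OF g eq_refl[OF z(2)[symmetric]]] by blast
  have EG: "E \<sqsubseteq> G" using append_right[OF E(1)] z(1) by simp
  have end_z: "f (P @ [b]) = f (P @ [z])" if "P @ [b] \<sqsubseteq> E" for P b
  proof (rule hom)
    show "P @ [b] \<sqsubseteq> G" using trans[OF that EG] .
    obtain E\<^sub>1 E\<^sub>2 where "E = E\<^sub>1 @ E\<^sub>2" "P \<sqsubseteq> E\<^sub>1" using split[OF \<open>P @ [b] \<sqsubseteq> E\<close>] by blast
    then have "P \<sqsubseteq> G'" using append_right trans E(1) by blast
    then show "P @ [z] \<sqsubseteq> G" using append[OF _ refl, of P G' "[z]"] z(1) by simp
  qed
  have *: "f P = f Q" if PQ: "P \<sqsubseteq> E" "Q \<sqsubseteq> E" "length P = length Q" "length P \<le> Suc s" for P Q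
  proof (cases P rule: rev_cases)
    case Nil
    then show ?thesis using PQ by simp
  next
    case (snoc P' b)
    then obtain Q' b' where Q': "Q = Q' @ [b']" using PQ(3) by (cases Q rule: rev_cases) auto
    have "P' \<sqsubseteq> E" "Q' \<sqsubseteq> E" 
      using split[of P' b E] split[of Q' b' E] PQ(1,2) append_right snoc Q' by auto
    moreover have "length P' = length Q'" "length P' \<le> s" using PQ(3,4) snoc Q' by auto
    ultimately have "?g P' = ?g Q'" by (rule mono)
    then have "?g P' div r = ?g Q' div r" by simp
    moreover have "?g K div r = f (K @ [z])" for K
      using Suc.prems(1)[of K] by simp
    ultimately have "f (P' @ [z]) = f (Q' @ [z])" by simp
    then show ?thesis using end_z[of P' b] end_z[of Q' b'] PQ snoc Q' by simp
  qed
  show ?case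
    by (intro exI[of _ E] conjI allI impI) (fact trans[OF EG G(1)], fact E(2), rule *)
qed

end

section \<open>The pigeonhole principle for lists\<close>

lemma length_eq_sum_filter:
  "(\<forall>x \<in> set xs. f x < r) \<Longrightarrow> length xs = (\<Sum>\<kappa><r. length (filter (\<lambda>x. f x = \<kappa>) xs))" for f :: "'a \<Rightarrow> nat"
proof (induction xs)
  case (Cons x xs)
  have "(\<Sum>\<kappa><r. length (filter (\<lambda>x. f x = \<kappa>) (x # xs)))
    = (\<Sum>\<kappa><r. (if \<kappa> = f x then 1 else 0) + length (filter (\<lambda>x. f x = \<kappa>) xs))"
    by (intro sum.cong) auto
  also have "\<dots> = Suc (length xs)"
    using Cons by (simp add: sum.distrib)
  finally show ?case by simp
qed simp

lemma pigeonhole_filter: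
  fixes f :: "'a \<Rightarrow> nat"
  assumes "\<And>x. f x < r" "r * m \<le> length xs"
  obtains \<kappa> where "m \<le> length (filter (\<lambda>x. f x = \<kappa>) xs)"
proof (rule ccontr)
  assume "\<not> thesis"
  then have *: "length (filter (\<lambda>x. f x = \<kappa>) xs) < m" for \<kappa> using that[of \<kappa>] by linarith
  have "r \<noteq> 0" using assms(1)[of undefined] by simp
  then have "(\<Sum>\<kappa><r. length (filter (\<lambda>x. f x = \<kappa>) xs)) < (\<Sum>\<kappa><r. m)"
    using * by (intro sum_strict_mono) auto
  then show False using length_eq_sum_filter[of xs f r] assms by simp
qed

section \<open>Ramsey's theorem\<close>

text \<open>The count is at most 2 to the length; base 3 is the one shared with block refinements,
  where merging is a third choice.\<close>

lemma card_subseqs: "card {P. subseq P D} \<le> 3 ^ length D"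
proof -
  have "{P. subseq P D} = set (subseqs D)" by auto
  then have "card {P. subseq P D} \<le> 2 ^ length D"
    using card_length[of "subseqs D"] by (simp add: length_subseqs)
  also have "\<dots> \<le> 3 ^ length D" by (rule power_mono) auto
  finally show ?thesis .
qed

interpretation ramsey: refinement subseq "\<lambda>m r. r * m"
proof
  fix D E F G P :: "'a list" and b :: 'a and f :: "'a \<Rightarrow> nat" and m r :: nat
  show "subseq D D" "subseq [] D" "\<not> subseq [b] []" by auto
  show "subseq D E \<Longrightarrow> subseq E F \<Longrightarrow> subseq D F" by (rule subseq_order.trans)
  show "subseq D F \<Longrightarrow> subseq E G \<Longrightarrow> subseq (D @ E) (F @ G)" by (rule list_emb_append_mono)
  show "\<exists>F G. D = F @ G \<and> subseq P F \<and> subseq [b] G" if "subseq (P @ [b]) D"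
    using list_emb_appendD[OF that] by blast
  have "{P. subseq P D} = set (subseqs D)" by auto
  then show "finite {P. subseq P D}" by simp
  show "card {P. subseq P D} \<le> 3 ^ length D" by (rule card_subseqs)
  show "\<exists>E. subseq E D \<and> length E = m \<and> (\<forall>b b'. subseq [b] E \<longrightarrow> subseq [b'] E \<longrightarrow> f b = f b')"
    if len: "r * m \<le> length D" and f: "\<And>b. f b < r"
  proof -
    obtain \<kappa> where \<kappa>: "m \<le> length (filter (\<lambda>x. f x = \<kappa>) D)"
      using pigeonhole_filter[of f, OF f len] .
    let ?E = "take m (filter (\<lambda>x. f x = \<kappa>) D)"
    have "subseq ?E (filter (\<lambda>x. f x = \<kappa>) D)"
      by (intro prefix_imp_subseq take_is_prefix)
    then have "subseq ?E D" using subseq_filter_left subseq_order.trans by blast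
    moreover have "f b = \<kappa>" if "subseq [b] ?E" for b
    proof -
      have "b \<in> set ?E" using that by (simp add: subseq_singleton_left)
      then show ?thesis by (auto dest: in_set_takeD)
    qed
    moreover have "length ?E = m" using \<kappa> by simp
    ultimately show ?thesis by metis
  qed
qed

section \<open>Folkman's theorem\<close>

primrec subset_sums :: "nat list \<Rightarrow> nat set" where
  "subset_sums [] = {0}"
| "subset_sums (a # as) = subset_sums as \<union> (+) a ` subset_sums as"

lemma zero_subset_sums: "0 \<in> subset_sums xs"
  by (induction xs) auto

lemma subset_sums_append: "subset_sums (xs @ ys) = {s + t | s t. s \<in> subset_sums xs \<and> t \<in> subset_sums ys}"
  by (induction xs) (auto simp: image_iff, (metis add.assoc)+)

lemma sum_list_subset_sums: "sum_list xs \<in> subset_sums xs"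
  by (induction xs) auto

lemma subset_sums_le: "s \<in> subset_sums xs \<Longrightarrow> s \<le> sum_list xs"
  by (induction xs arbitrary: s) (auto intro: le_SucI add_mono trans_le_add2)

lemma subset_sums_appendI: "s \<in> subset_sums xs \<Longrightarrow> t \<in> subset_sums ys \<Longrightarrow> s + t \<in> subset_sums (xs @ ys)"
  by (auto simp: subset_sums_append)

lemma subset_sums_append_left: "subset_sums xs \<subseteq> subset_sums (xs @ ys)"
  using zero_subset_sums[of ys] by (force simp: subset_sums_append)

text \<open>A solution of r * N ^ (2 * M) < N' for consecutive bounds N, N'. The exponent has to be
  multiplied by more than 2 * M, for which 4 ^ (2 * M + 1) suffices, and 2 * M + 1 is the difference
  of consecutive squares; the base r + 2 absorbs the factor r.\<close>

definition box_bound :: "nat \<Rightarrow> nat \<Rightarrow> nat" where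
  "box_bound r M = (r + 2) ^ (4 ^ (M * M))"

lemma box_bound_Suc: "r * (box_bound r M * box_bound r M) ^ M < box_bound r (Suc M)"
  and box_bound_mono: "box_bound r M \<le> box_bound r (Suc M)"
proof -
  let ?e = "4 ^ (M * M) :: nat"
  have "(1::nat) + ?e * (2 * M) \<le> ?e + ?e * (2 * M)" by simp
  also have "\<dots> = ?e * Suc (2 * M)" by simp
  also have "\<dots> \<le> ?e * 4 ^ Suc (2 * M)"
    by (intro mult_left_mono less_imp_le[OF n_less_m_mult_n] less_imp_le[OF power_gt_expt]) auto
  also have "\<dots> = 4 ^ (M * M + Suc (2 * M))" by (simp only: power_add)
  also have "M * M + Suc (2 * M) = Suc M * Suc M" by simp
  finally have e: "1 + ?e * (2 * M) \<le> 4 ^ (Suc M * Suc M)" .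
  have "r * (box_bound r M * box_bound r M) ^ M = r * (r + 2) ^ (?e * (2 * M))"
    by (simp add: box_bound_def power2_eq_square[symmetric] power_mult[symmetric])
  also have "\<dots> < (r + 2) ^ (1 + ?e * (2 * M))" by simp
  also have "\<dots> \<le> box_bound r (Suc M)" unfolding box_bound_def by (intro power_increasing e) auto
  finally show "r * (box_bound r M * box_bound r M) ^ M < box_bound r (Suc M)" .
  show "box_bound r M \<le> box_bound r (Suc M)"
    unfolding box_bound_def by (intro power_increasing) auto
qed

text \<open>The Kovari--Sos--Turan argument.\<close>

lemma monochromatic_box:
  fixes c :: "nat list \<Rightarrow> nat"
  assumes "\<And>t. c t < r"
  shows "\<exists>bs. length bs = M \<and> (\<forall>(l, u) \<in> set bs. l < u \<and> u < box_bound r M) \<and>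
    (\<exists>\<kappa>. \<forall>t. list_all2 (\<lambda>x (l, u). x = l \<or> x = u) t bs \<longrightarrow> c t = \<kappa>)"
  using assms
proof (induction M arbitrary: c)
  case (Suc M)
  let ?N = "box_bound r M" and ?N' = "box_bound r (Suc M)"
  define box where "box y bs \<kappa> \<longleftrightarrow> length bs = M \<and> (\<forall>(l, u) \<in> set bs. l < u \<and> u < ?N) \<and>
    (\<forall>t. list_all2 (\<lambda>x (l, u). x = l \<or> x = u) t bs \<longrightarrow> c (y # t) = \<kappa>)" for y bs \<kappa>
  have "\<exists>bs \<kappa>. box y bs \<kappa>" for y
    using Suc.IH[of "\<lambda>t. c (y # t)"] Suc.prems unfolding box_def by blast
  then obtain B \<kappa> where box: "box y (B y) (\<kappa> y)" for y by metis
  have B: "length (B y) = M" "(l, u) \<in> set (B y) \<Longrightarrow> l < u \<and> u < ?N"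
    "list_all2 (\<lambda>x (l, u). x = l \<or> x = u) t (B y) \<Longrightarrow> c (y # t) = \<kappa> y" for y l u t
    using box[of y] by (auto simp: box_def)
  have \<kappa>: "\<kappa> y < r" for y
  proof -
    have "list_all2 (\<lambda>x (l, u). x = l \<or> x = u) (map fst (B y)) (B y)"
      by (auto simp: list_all2_conv_all_nth split: prod.splits)
    from B(3)[OF this] show ?thesis using Suc.prems[of "y # map fst (B y)"] by simp
  qed
  let ?Q = "{bs. set bs \<subseteq> {..<?N} \<times> {..<?N} \<and> length bs = M} \<times> {..<r}"
  have fin: "finite ?Q" by (intro finite_cartesian_product finite_lists_length_eq) auto
  \<comment> \<open>Each value y of the first coordinate yields a box in the remaining ones and its
    colour. There are fewer such pairs than values y below \<open>?N'\<close>, so two values share a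
    pair and become the new side of the box.\<close>
  have "(\<lambda>y. (B y, \<kappa> y)) ` {..<?N'} \<subseteq> ?Q"
    using B(1,2) \<kappa> by (force dest: less_trans)
  then have "card ((\<lambda>y. (B y, \<kappa> y)) ` {..<?N'}) \<le> card ?Q" by (rule card_mono[OF fin])
  also have "\<dots> = r * (?N * ?N) ^ M"
    by (simp add: card_cartesian_product card_lists_length_eq)
  also have "\<dots> < card {..<?N'}" using box_bound_Suc by simp
  finally obtain y y' where y: "y < y'" "y' < ?N'" "B y = B y'" "\<kappa> y = \<kappa> y'"
    using pigeonhole unfolding inj_on_def by (metis (no_types, lifting) lessThan_iff linorder_neqE_nat prod.inject)
  show ?case
  proof (intro exI[of _ "(y, y') # B y"] conjI exI[of _ "\<kappa> y"] allI impI)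
    show "\<forall>(l, u)\<in>set ((y, y') # B y). l < u \<and> u < ?N'"
      using y B(2) box_bound_mono[of r M] by fastforce
    show "c t = \<kappa> y" if "list_all2 (\<lambda>x (l, u). x = l \<or> x = u) t ((y, y') # B y)" for t
      using that B(3)[of _ y] B(3)[of _ y'] y by (auto simp: list_all2_Cons2)
  qed (use B in auto)
qed auto

lemma split_into_blocks:
  "M * N \<le> length e \<Longrightarrow> \<exists>B R. e = concat B @ R \<and> length B = M \<and> (\<forall>b \<in> set B. length b = N)"
proof (induction M arbitrary: e)
  case (Suc M)
  then obtain B R where "drop N e = concat B @ R" "length B = M" "\<forall>b \<in> set B. length b = N"
    by (metis add_le_imp_le_diff length_drop mult_Suc add.commute)
  moreover have "length (take N e) = N" using Suc.prems by simp
  ultimately show ?case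
    by (intro exI[of _ "take N e # B"] exI[of _ R]) (auto, metis append_take_drop_id append_assoc)
qed (auto intro: exI[of _ "[]"])

text \<open>\<open>e\<close> is cut into M + 1 blocks, and coordinate i selects a prefix of block i.
  In a monochromatic box the sides l < u give the prefix sum up to l, which goes into the base point
  \<open>a\<close>, and the sum of the segment from l to u, which is an entry of \<open>d\<close>.
  The corners of the box are the sums a + s.\<close>

lemma subset_sums_cube:
  fixes g :: "nat \<Rightarrow> nat"
  assumes g: "\<And>x. g x < r" and e: "\<forall>x \<in> set e. 0 < x" "Suc M * box_bound r (Suc M) \<le> length e"
  obtains a d where "0 < a" "length d = Suc M" "\<forall>x \<in> set d. 0 < x"
    "subset_sums (a # d) \<subseteq> subset_sums e" "\<forall>s \<in> subset_sums d. g (a + s) = g a"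
proof -
  let ?N = "box_bound r (Suc M)"
  let ?R = "\<lambda>x :: nat. \<lambda>(l, u). x = l \<or> x = u"
  obtain B R where B: "e = concat B @ R" "length B = Suc M" "\<forall>b \<in> set B. length b = ?N"
    using split_into_blocks[OF e(2)] by blast
  \<comment> \<open>\<open>Suc x\<close> makes every prefix nonempty, which keeps the base point
    positive; x < N still leaves the prefix inside a block of length N.\<close>
  define val where "val B t = sum_list (map2 (\<lambda>b x. sum_list (take (Suc x) b)) B t)"
    for B :: "nat list list" and t
  define dif where "dif B bs = map2 (\<lambda>b (l, u). sum_list (take (u - l) (drop (Suc l) b))) B bs"
    for B :: "nat list list" and bs
  obtain bs \<kappa> where bs: "length bs = Suc M" "\<forall>(l, u) \<in> set bs. l < u \<and> u < ?N"
    and \<kappa>: "\<And>t. list_all2 ?R t bs \<Longrightarrow> g (val B t) = \<kappa>"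
    using monochromatic_box[of "\<lambda>t. g (val B t)" r "Suc M"] g by blast
  \<comment> \<open>Prefix and segment are disjoint parts of a block, so s and a + s are both sums
    over the blocks; choosing l or u in each coordinate gives the corner that belongs to s.\<close>
  have sums: "s \<in> subset_sums (concat B) \<and> val B (map fst bs) + s \<in> subset_sums (concat B) \<and>
      (\<exists>t. list_all2 ?R t bs \<and> val B t = val B (map fst bs) + s)"
    if "length B = length bs" "\<forall>(l, u) \<in> set bs. l < u" "s \<in> subset_sums (dif B bs)" for B bs s
    using that
  proof (induction B bs arbitrary: s rule: list_induct2)
    case (Cons b B p bs)
    obtain l u where p: "p = (l, u)" by force
    have lu: "l < u" using Cons.prems p by auto
    define b\<^sub>1 b\<^sub>2 b\<^sub>3 where
      "b\<^sub>1 = take (Suc l) b" "b\<^sub>2 = take (u - l) (drop (Suc l) b)" "b\<^sub>3 = drop (Suc u) b"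
    note bs_def = this
    have tu: "take (Suc u) b = b\<^sub>1 @ b\<^sub>2"
      using lu take_add[of "Suc l" "u - l" b] by (simp add: bs_def)
    then have b: "b = b\<^sub>1 @ b\<^sub>2 @ b\<^sub>3"
      using append_take_drop_id[of "Suc u" b] by (simp add: bs_def)
    have mb: "sum_list b\<^sub>2 \<in> subset_sums b" "sum_list b\<^sub>1 \<in> subset_sums b"
      "sum_list b\<^sub>1 + sum_list b\<^sub>2 \<in> subset_sums b"
      unfolding b
      using subset_sums_appendI[OF zero_subset_sums subset_sums_appendI[OF sum_list_subset_sums zero_subset_sums], of b\<^sub>2 b\<^sub>1 b\<^sub>3]
        subset_sums_appendI[OF sum_list_subset_sums zero_subset_sums, of b\<^sub>1 "b\<^sub>2 @ b\<^sub>3"]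
        subset_sums_appendI[OF sum_list_subset_sums subset_sums_appendI[OF sum_list_subset_sums zero_subset_sums], of b\<^sub>1 b\<^sub>2 b\<^sub>3]
      by simp_all
    have dif: "dif (b # B) (p # bs) = sum_list b\<^sub>2 # dif B bs" by (simp add: dif_def p bs_def)
    have val: "val (b # B) (x # t) = sum_list (take (Suc x) b) + val B t" for x t by (simp add: val_def)
    from Cons.prems(2) dif obtain s' where s': "s' \<in> subset_sums (dif B bs)"
      and s: "s = s' \<or> s = sum_list b\<^sub>2 + s'" by auto
    from Cons.IH[OF _ s'] Cons.prems obtain t where t: "s' \<in> subset_sums (concat B)"
      "val B (map fst bs) + s' \<in> subset_sums (concat B)"
      "list_all2 ?R t bs" "val B t = val B (map fst bs) + s'" by auto
    have in_sums: "x + y \<in> subset_sums (concat (b # B))"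
      if "x \<in> subset_sums b" "y \<in> subset_sums (concat B)" for x y
      using that by (auto simp: subset_sums_append)
    from s show ?case
    proof
      assume "s = s'"
      then show ?thesis
        using in_sums[OF zero_subset_sums t(1)] in_sums[OF mb(2) t(2)] t(3,4)
        by (auto simp: p val add.assoc bs_def intro!: exI[of _ "l # t"])
    next
      assume "s = sum_list b\<^sub>2 + s'"
      then show ?thesis
        using in_sums[OF mb(1) t(1)] in_sums[OF mb(3) t(2)] t(3,4) tu
        by (auto simp: p val ac_simps bs_def[symmetric] intro!: exI[of _ "u # t"])
    qed
  qed (auto simp: dif_def val_def)
  let ?a = "val B (map fst bs)" and ?d = "dif B bs"
  have lB: "length B = length bs" and less: "\<forall>(l, u) \<in> set bs. l < u" using B bs by auto
  have pos: "0 < sum_list xs" if "xs \<noteq> []" "set xs \<subseteq> set e" for xs :: "nat list"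
    using that e(1) by (cases xs) auto
  have sub: "set b \<subseteq> set e" if "b \<in> set B" for b using that B(1) by auto
  show ?thesis
  proof (rule that[of ?a ?d])
    obtain b B' p bs' where *: "B = b # B'" "bs = p # bs'"
      using B(2) bs(1) by (cases B; cases bs) auto
    have "0 < ?N" by (simp add: box_bound_def)
    then have "b \<noteq> []" using B(3) * by auto
    then have "0 < sum_list (take (Suc (fst p)) b)"
      using sub[of b] * set_take_subset[of "Suc (fst p)" b] by (intro pos) auto
    then show "0 < ?a" by (simp add: * val_def)
    show "length ?d = Suc M" using B bs by (simp add: dif_def)
    show "\<forall>x \<in> set ?d. 0 < x"
    proof
      fix x assume "x \<in> set ?d"
      then obtain b l u where x: "x = sum_list (take (u - l) (drop (Suc l) b))" "(b, (l, u)) \<in> set (zip B bs)"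
        by (auto simp: dif_def)
      then have "b \<in> set B" "l < u" "u < ?N" "length b = ?N"
        using bs(2) B(3) by (auto dest: set_zip_leftD set_zip_rightD)
      moreover have "set (take (u - l) (drop (Suc l) b)) \<subseteq> set b"
        by (meson set_drop_subset set_take_subset subset_trans)
      ultimately show "0 < x" unfolding x(1) using sub[of b] by (intro pos) auto
    qed
    show "subset_sums (?a # ?d) \<subseteq> subset_sums e"
      using sums[OF lB less] subset_sums_append_left[of "concat B" R] B(1) by auto
    have \<kappa>': "g (?a + s) = \<kappa>" if s: "s \<in> subset_sums ?d" for s
    proof -
      obtain t where "list_all2 ?R t bs" "val B t = ?a + s" using sums[OF lB less s] by blast
      then show ?thesis using \<kappa>[of t] by simp
    qed
    show "\<forall>s \<in> subset_sums ?d. g (?a + s) = g ?a"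
      using \<kappa>' \<kappa>'[OF zero_subset_sums] by simp
  qed
qed

section \<open>Sums whose colour is that of the first summand\<close>

fun folkman_bound :: "nat \<Rightarrow> nat \<Rightarrow> nat" where
  "folkman_bound r 0 = 0"
| "folkman_bound r (Suc j) = Suc (folkman_bound r j) * box_bound r (Suc (folkman_bound r j))"

primrec first_determined :: "(nat \<Rightarrow> nat) \<Rightarrow> nat list \<Rightarrow> bool" where
  "first_determined g [] = True"
| "first_determined g (a # as) = ((\<forall>s \<in> subset_sums as. g (a + s) = g a) \<and> first_determined g as)"

text \<open>The base point of a cube becomes the first summand. All later summands are sums over its
  differences, so adding them does not change the colour of the base point.\<close>

lemma ex_first_determined:
  fixes g :: "nat \<Rightarrow> nat"
  assumes g: "\<And>x. g x < r" and e: "\<forall>x \<in> set e. 0 < x" "folkman_bound r j \<le> length e"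
  shows "\<exists>as. length as = j \<and> (\<forall>x \<in> set as. 0 < x) \<and> subset_sums as \<subseteq> subset_sums e \<and> first_determined g as"
  using e
proof (induction j arbitrary: e)
  case 0
  then show ?case using zero_subset_sums by (intro exI[of _ "[]"]) auto
next
  case (Suc j)
  obtain a d where d: "0 < a" "length d = Suc (folkman_bound r j)" "\<forall>x \<in> set d. 0 < x"
    "subset_sums (a # d) \<subseteq> subset_sums e" "\<forall>s \<in> subset_sums d. g (a + s) = g a"
    using subset_sums_cube[of g r e "folkman_bound r j"] g Suc.prems by auto
  obtain as where as: "length as = j" "\<forall>x \<in> set as. 0 < x" "subset_sums as \<subseteq> subset_sums d"
    "first_determined g as"
    using Suc.IH[of d] d by auto
  have "subset_sums (a # as) \<subseteq> subset_sums (a # d)" using as(3) by auto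
  then have "subset_sums (a # as) \<subseteq> subset_sums e" using d(4) by (rule subset_trans)
  then show ?case
    using d(1,5) as by (intro exI[of _ "a # as"]) (auto simp del: subset_sums.simps)
qed

lemma subset_sums_filter: "subset_sums (filter P as) \<subseteq> subset_sums as"
  by (induction as) auto

lemma first_determined_filter:
  assumes "first_determined g as" "s \<in> subset_sums (filter (\<lambda>a. g a = \<kappa>) as)" "s \<noteq> 0"
  shows "g s = \<kappa>"
  using assms
proof (induction as arbitrary: s)
  case (Cons a as)
  let ?F = "filter (\<lambda>a. g a = \<kappa>) as"
  consider "s \<in> subset_sums ?F" | s' where "g a = \<kappa>" "s = a + s'" "s' \<in> subset_sums ?F"
    using Cons.prems(2) by (auto split: if_splits)
  then show ?case
  proof cases
    case 1
    have "first_determined g as" using Cons.prems(1) by simp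
    from Cons.IH[OF this 1 Cons.prems(3)] show ?thesis .
  next
    case 2
    have "s' \<in> subset_sums as" using 2(3) subset_sums_filter by blast
    moreover have "\<forall>s \<in> subset_sums as. g (a + s) = g a" using Cons.prems(1) by simp
    ultimately have "g (a + s') = g a" by blast
    then show ?thesis using 2 by simp
  qed
qed simp

text \<open>The colour of a sum is that of its first summand, so a colour taken m times among r * m
  summands is the colour of all sums of those m.\<close>

theorem folkman:
  fixes g :: "nat \<Rightarrow> nat"
  assumes g: "\<And>x. g x < r"
  obtains xs \<kappa> where "length xs = m" "\<forall>x \<in> set xs. 0 < x" "sum_list xs \<le> folkman_bound r (r * m)"
    "\<And>s. s \<in> subset_sums xs \<Longrightarrow> s \<noteq> 0 \<Longrightarrow> g s = \<kappa>"
proof -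
  let ?T = "folkman_bound r (r * m)"
  \<comment> \<open>Starting from \<open>?T\<close> ones keeps every sum at most
    \<open>?T\<close>.\<close>
  obtain as where as: "length as = r * m" "\<forall>x \<in> set as. 0 < x"
    "subset_sums as \<subseteq> subset_sums (replicate ?T 1)" "first_determined g as"
    using ex_first_determined[of g r "replicate ?T 1" "r * m"] g by auto
  obtain \<kappa> where \<kappa>: "m \<le> length (filter (\<lambda>x. g x = \<kappa>) as)"
    using pigeonhole_filter[of g r m as] g as(1) by auto
  let ?F = "filter (\<lambda>x. g x = \<kappa>) as"
  have sub: "subset_sums (take m ?F) \<subseteq> subset_sums ?F"
    using subset_sums_append_left[of "take m ?F" "drop m ?F"] by simp
  show ?thesis
  proof (rule that[of "take m ?F" \<kappa>])
    show "length (take m ?F) = m" using \<kappa> by simp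
    show "\<forall>x \<in> set (take m ?F). 0 < x" using as(2) by (auto dest: in_set_takeD)
    have "sum_list (take m ?F) \<in> subset_sums (replicate ?T 1)"
      using sub as(3) sum_list_subset_sums subset_sums_filter by blast
    then show "sum_list (take m ?F) \<le> ?T"
      using subset_sums_le by (fastforce simp: sum_list_replicate)
    show "g s = \<kappa>" if "s \<in> subset_sums (take m ?F)" "s \<noteq> 0" for s
      using first_determined_filter[OF as(4)] sub that by blast
  qed
qed

section \<open>The finite unions theorem and the finite Milliken--Taylor theorem\<close>

text \<open>\<open>Ds\<close> groups chosen terms of \<open>E\<close>. Unions are concatenations: if
  the blocks are listed in increasing order, the union of blocks taken in order is again so
  listed.\<close>

definition block_refines :: "'a list list \<Rightarrow> 'a list list \<Rightarrow> bool" where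
  "block_refines D E \<longleftrightarrow> (\<exists>Ds. D = map concat Ds \<and> subseq (concat Ds) E \<and> [] \<notin> set Ds)"

lemma subseq_map_right: "subseq F (map f xs) \<Longrightarrow> \<exists>ys. F = map f ys \<and> subseq ys xs"
proof (induction xs arbitrary: F)
  case (Cons x xs)
  consider "subseq F (map f xs)" | G where "F = f x # G" "subseq G (map f xs)"
    using Cons.prems by (auto elim: list_emb.cases)
  then show ?case
  proof cases
    case 1
    then show ?thesis using Cons.IH by blast
  next
    case 2
    then obtain ys where "G = map f ys" "subseq ys xs" using Cons.IH by blast
    then show ?thesis using 2 by (intro exI[of _ "x # ys"]) auto
  qed
qed (auto dest: list_emb_Nil2)

lemma subseq_set: "subseq xs ys \<Longrightarrow> set xs \<subseteq> set ys"
  by (auto elim: list_emb_set)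

lemma subseq_sorted_wrt: "subseq xs ys \<Longrightarrow> sorted_wrt R ys \<Longrightarrow> sorted_wrt R xs"
  by (induction rule: list_emb.induct) (auto dest: subseq_set)

lemma subseq_concat: "subseq xs ys \<Longrightarrow> subseq (concat xs) (concat ys)"
  by (induction rule: list_emb.induct) (auto intro: list_emb_append_mono)

lemma concat_map_concat: "concat (map concat xs) = concat (concat xs)"
  by (induction xs) auto

lemma concat_eq_map: "concat Ds = map f xs \<Longrightarrow> \<exists>Xs. Ds = map (map f) Xs \<and> concat Xs = xs"
proof (induction Ds arbitrary: xs)
  case (Cons D Ds)
  then obtain ys zs where *: "xs = ys @ zs" "D = map f ys" "concat Ds = map f zs"
    by (auto simp: append_eq_map_conv)
  from Cons.IH[OF *(3)] obtain Xs where "Ds = map (map f) Xs" "concat Xs = zs" by blast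
  with * show ?case by (intro exI[of _ "ys # Xs"]) auto
qed auto

lemma block_refines_trans:
  assumes "block_refines D E" "block_refines E F"
  shows "block_refines D F"
proof -
  obtain Ds Es where D: "D = map concat Ds" "subseq (concat Ds) E" "[] \<notin> set Ds"
    and E: "E = map concat Es" "subseq (concat Es) F" "[] \<notin> set Es"
    using assms by (auto simp: block_refines_def)
  from subseq_map_right[OF D(2)[unfolded E(1)]] obtain Gs where
    Gs: "concat Ds = map concat Gs" "subseq Gs Es" by blast
  \<comment> \<open>The groups of \<open>D\<close> are groups of groups of \<open>F\<close>;
    flattening them by one level gives the witness.\<close>
  from concat_eq_map[OF Gs(1)] obtain Hs where Hs: "Ds = map (map concat) Hs" "concat Hs = Gs" by blast
  have "[] \<notin> set Gs" using Gs(2) E(3) subseq_set by blast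
  have "concat H \<noteq> []" if "H \<in> set Hs" for H
  proof -
    have "H \<noteq> []" using D(3) Hs(1) that by force
    moreover have "set H \<subseteq> set Gs" using that Hs(2) by auto
    ultimately show ?thesis using \<open>[] \<notin> set Gs\<close> by (cases H) auto
  qed
  then have "[] \<notin> set (map concat Hs)" unfolding set_map by (metis imageE)
  moreover have "D = map concat (map concat Hs)" using D(1) Hs(1) by (simp add: concat_map_concat)
  moreover have "subseq (concat (map concat Hs)) F"
  proof -
    have "subseq (concat Gs) (concat Es)" using Gs(2) by (rule subseq_concat)
    then show ?thesis using subseq_order.trans[OF _ E(2)] Hs(2) by (simp add: concat_map_concat)
  qed
  ultimately show ?thesis unfolding block_refines_def by blast
qed

text \<open>The term \<open>x\<close> is skipped, is a block of its own, or is merged into the front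
  of the first block; hence the base 3 of the count.\<close>

lemma block_refinements_Cons:
  "{P. block_refines P (x # D)} \<subseteq> {P. block_refines P D} \<union> (#) x ` {P. block_refines P D} \<union>
    (\<lambda>P. (x @ hd P) # tl P) ` {P. block_refines P D}"
proof
  fix P assume "P \<in> {P. block_refines P (x # D)}"
  then obtain Ps where P: "P = map concat Ps" "subseq (concat Ps) (x # D)" "[] \<notin> set Ps"
    by (auto simp: block_refines_def)
  show "P \<in> {P. block_refines P D} \<union> (#) x ` {P. block_refines P D} \<union>
    (\<lambda>P. (x @ hd P) # tl P) ` {P. block_refines P D}"
  proof (cases "subseq (concat Ps) D")
    case True
    then show ?thesis using P by (auto simp: block_refines_def)
  next
    case False
    then obtain C where C: "concat Ps = x # C" "subseq C D"
      using P(2) by (auto elim: list_emb.cases)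
    then obtain P\<^sub>1 Ps' where Ps: "Ps = P\<^sub>1 # Ps'" by (cases Ps) auto
    moreover obtain y Q where "P\<^sub>1 = y # Q" using P(3) Ps by (cases P\<^sub>1) auto
    ultimately have Q: "Ps = (x # Q) # Ps'" "C = Q @ concat Ps'" using C(1) by auto
    show ?thesis
    proof (cases "Q = []")
      case True
      then have "block_refines (map concat Ps') D" using C Q P(3) by (auto simp: block_refines_def)
      then show ?thesis using P(1) Q True by auto
    next
      case False
      then have "block_refines (map concat (Q # Ps')) D"
        using C Q P(3) unfolding block_refines_def by (intro exI[of _ "Q # Ps'"]) auto
      then have "(x @ hd (map concat (Q # Ps'))) # tl (map concat (Q # Ps'))
          \<in> (\<lambda>P. (x @ hd P) # tl P) ` {P. block_refines P D}" by blast
      then show ?thesis using P(1) Q by simp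
    qed
  qed
qed

lemma block_refinements:
  "finite {P. block_refines P D} \<and> card {P. block_refines P D} \<le> 3 ^ length D"
proof (induction D)
  case Nil
  have "{P. block_refines P []} = {[] :: 'a list list}"
  proof -
    have "P = []" if P: "block_refines P ([] :: 'a list list)" for P :: "'a list list"
    proof -
      obtain Ds where "P = map concat Ds" "subseq (concat Ds) ([] :: 'a list list)" "[] \<notin> set Ds"
        using P unfolding block_refines_def by blast
      then show ?thesis using list_emb_Nil2 by (cases Ds) fastforce+
    qed
    moreover have "block_refines [] ([] :: 'a list list)"
      unfolding block_refines_def by (intro exI[of _ "[]"]) auto
    ultimately show ?thesis by auto
  qed
  then show ?case by simp
next
  case (Cons x D)
  let ?S = "{P. block_refines P D}"
  let ?U = "?S \<union> (#) x ` ?S \<union> (\<lambda>P. (x @ hd P) # tl P) ` ?S"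
  have fin: "finite ?U" using Cons by auto
  have "card ?U \<le> card ?S + card ((#) x ` ?S) + card ((\<lambda>P. (x @ hd P) # tl P) ` ?S)"
    by (meson add_mono card_Un_le le_refl le_trans)
  also have "\<dots> \<le> card ?S + card ?S + card ?S"
    using Cons by (intro add_mono card_image_le) auto
  also have "\<dots> \<le> 3 ^ length (x # D)" using Cons by simp
  finally show ?case
    using finite_subset[OF block_refinements_Cons fin] card_mono[OF fin block_refinements_Cons[of x D]]
    by linarith
qed

text \<open>\<open>p\<close> lists the endpoints of half-open intervals [i, j) of positions.
  Representing a union by its endpoints makes it a tuple, to which Ramsey's theorem applies.\<close>

fun intervals :: "'a list \<Rightarrow> nat list \<Rightarrow> 'a list" where
  "intervals D (i # j # p) = take (j - i) (drop i D) @ intervals D p"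
| "intervals D p = []"

lemma intervals_append: "even (length p) \<Longrightarrow> intervals D (p @ q) = intervals D p @ intervals D q"
  by (induction D p rule: intervals.induct) auto

lemma intervals_concat:
  "(\<forall>p \<in> set ps. even (length p)) \<Longrightarrow> intervals D (concat ps) = concat (map (intervals D) ps)"
  by (induction ps) (auto simp: intervals_append)

lemma subseq_intervals:
  "sorted p \<Longrightarrow> \<forall>x \<in> set p. n \<le> x \<Longrightarrow> subseq (intervals D p) (drop n D)"
proof (induction D p arbitrary: n rule: intervals.induct)
  case (1 D i j p)
  have "subseq (intervals D p) (drop j D)" using 1 by (intro "1.IH") auto
  then have "subseq (take (j - i) (drop i D) @ intervals D p) (take (j - i) (drop i D) @ drop j D)"
    by (intro list_emb_append_mono subseq_order.refl)
  moreover have "take (j - i) (drop i D) @ drop j D = drop i D"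
    using 1(2) append_take_drop_id[of "j - i" "drop i D"] by simp
  moreover have "subseq (drop i D) (drop n D)"
    using 1(3) suffix_drop[of "i - n" "drop n D"] by (intro suffix_imp_subseq) simp
  ultimately show ?case using subseq_order.trans[of _ "drop i D" "drop n D"] by simp
qed auto

lemma split_lengths: "sum_list ns \<le> length p \<Longrightarrow> \<exists>ps q. p = concat ps @ q \<and> map length ps = ns"
proof (induction ns arbitrary: p)
  case (Cons n ns)
  then have "sum_list ns \<le> length (drop n p)" by simp
  then obtain ps q where "drop n p = concat ps @ q" "map length ps = ns"
    using Cons.IH by blast
  then show ?case using Cons.prems append_take_drop_id[of n p]
    by (intro exI[of _ "take n p # ps"] exI[of _ q]) auto
qed auto

text \<open>An integer x of Folkman's theorem stands for x intervals, that is 2 * x endpoints; a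
  choice of groups of endpoints thus corresponds to a sum.\<close>

lemma length_concat_subseq:
  assumes "subseq qs ps" "map length ps = map ((*) 2) xs"
  shows "\<exists>s \<in> subset_sums xs. length (concat qs) = 2 * s"
  using assms
proof (induction arbitrary: xs rule: list_emb.induct)
  case (list_emb_Nil ys)
  then show ?case using zero_subset_sums by force
next
  case (list_emb_Cons qs ps p)
  then show ?case by (cases xs) auto
next
  case (list_emb_Cons2 q p qs ps)
  then obtain x xs' where "xs = x # xs'" "length p = 2 * x" "map length ps = map ((*) 2) xs'"
    by (cases xs) auto
  moreover from this obtain s where "s \<in> subset_sums xs'" "length (concat qs) = 2 * s"
    using list_emb_Cons2 by blast
  ultimately show ?case using list_emb_Cons2 by (intro bexI[of _ "x + s"]) auto
qed

text \<open>\<open>T\<close> bounds the sums in Folkman's theorem, so unions have up to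
  \<open>2 * T\<close> endpoints.\<close>

definition finite_unions_bound :: "nat \<Rightarrow> nat \<Rightarrow> nat" where
  "finite_unions_bound m r = (let T = folkman_bound r (r * m) in
     tuple_bound (\<lambda>m r. r * m) (2 * T) (2 * T) r)"

text \<open>
  By Ramsey's theorem there are positions such that the colour of a union of \<open>t\<close> of the intervals
  they determine depends only on \<open>t\<close>, which leaves Folkman's theorem.
\<close>

theorem finite_unions:
  fixes f :: "'a list \<Rightarrow> nat"
  assumes len: "finite_unions_bound m r \<le> length D" and f: "\<And>b. f b < r"
  shows "\<exists>E. block_refines E D \<and> length E = m \<and>
    (\<forall>b b'. block_refines [b] E \<longrightarrow> block_refines [b'] E \<longrightarrow> f b = f b')"
proof -
  define T where "T = folkman_bound r (r * m)"
  define \<phi> where "\<phi> p = f (concat (intervals D p))" for p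
  \<comment> \<open>A list of length n has n + 1 cut points, from 0 to n.\<close>
  have "tuple_bound (\<lambda>m r. r * m) (2 * T) (2 * T) r \<le> length [0..<Suc (length D)]"
    using len by (simp add: finite_unions_bound_def T_def Let_def)
  from ramsey.tuples[OF _ this, of \<phi>] f obtain p where
    p: "subseq p [0..<Suc (length D)]" "length p = 2 * T"
    and mono: "\<And>P Q. subseq P p \<Longrightarrow> subseq Q p \<Longrightarrow> length P = length Q \<Longrightarrow> length P \<le> 2 * T \<Longrightarrow> \<phi> P = \<phi> Q"
    unfolding \<phi>_def by blast
  have sorted: "sorted_wrt (<) P" "\<forall>x \<in> set P. x \<le> length D" if "subseq P p" for P
  proof -
    have P: "subseq P [0..<Suc (length D)]" using that p(1) by (rule subseq_order.trans)
    have "sorted_wrt (<) [0..<Suc (length D)]" by (rule sorted_wrt_upt)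
    then show "sorted_wrt (<) P" using P by (rule subseq_sorted_wrt[rotated])
    show "\<forall>x \<in> set P. x \<le> length D" using P subseq_set[of P "[0..<Suc (length D)]"] by (auto simp del: upt_Suc)
  qed
  \<comment> \<open>As only the number of intervals matters, the first 2 * s endpoints represent
    every union of s intervals.\<close>
  obtain xs \<kappa> where xs: "length xs = m" "\<forall>x \<in> set xs. 0 < x" "sum_list xs \<le> T"
    and \<kappa>: "\<And>s. s \<in> subset_sums xs \<Longrightarrow> s \<noteq> 0 \<Longrightarrow> \<phi> (take (2 * s) p) = \<kappa>"
    using folkman[of "\<lambda>s. \<phi> (take (2 * s) p)" r m] f unfolding \<phi>_def T_def by blast
  have "sum_list (map ((*) 2) xs) \<le> length p"
    using xs(3) p(2) by (simp add: sum_list_const_mult)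
  \<comment> \<open>Consecutive groups of endpoints, two for each unit of an entry of
    \<open>xs\<close>; the intervals of one group will form one block of \<open>E\<close>.\<close>
  from split_lengths[OF this] obtain ps q where ps: "p = concat ps @ q" "map length ps = map ((*) 2) xs"
    by blast
  have concat_ps: "subseq (concat ps) p" unfolding ps(1) by (rule list_emb_prefix) simp
  have even: "even (length P)" "P \<noteq> []" if "P \<in> set ps" for P
  proof -
    have "length P \<in> set (map ((*) 2) xs)" using that ps(2) by (metis image_eqI set_map)
    then show "even (length P)" "P \<noteq> []" using xs(2) by auto
  qed
  define E where "E = map concat (map (intervals D) ps)"
  show ?thesis
  proof (intro exI[of _ E] conjI allI impI)
    show "block_refines E D"
      unfolding block_refines_def
    proof (intro exI conjI)
      show "E = map concat (map (intervals D) ps)" by (rule E_def)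
      have "subseq (intervals D (concat ps)) (drop 0 D)"
        using sorted(1)[OF concat_ps] by (intro subseq_intervals) (auto simp: strict_sorted_iff)
      then show "subseq (concat (map (intervals D) ps)) D" using even by (simp add: intervals_concat)
      have "intervals D P \<noteq> []" if P: "P \<in> set ps" for P
      proof -
        obtain i j P' where ij: "P = i # j # P'"
          using even[OF P] by (cases P; cases "tl P") auto
        have "subseq P (concat ps)"
          using subseq_concat[of "[P]" ps] P by (simp add: subseq_singleton_left)
        from sorted[OF subseq_order.trans[OF this concat_ps]] show ?thesis unfolding ij by auto
      qed
      then show "[] \<notin> set (map (intervals D) ps)" unfolding set_map by (metis imageE)
    qed
    show "length E = m" using ps(2) xs(1) unfolding E_def by (metis length_map)
    have col: "f b = \<kappa>" if b: "block_refines [b] E" for b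
    proof -
      obtain Ds where Ds: "[b] = map concat Ds" "subseq (concat Ds) E" "[] \<notin> set Ds"
        using b unfolding block_refines_def by (elim exE conjE)
      then obtain F where "Ds = [F]" by (cases Ds) auto
      then have F: "F \<noteq> []" "subseq F E" "b = concat F" using Ds by auto
      from subseq_map_right[OF F(2)[unfolded E_def map_map]] obtain qs where
        qs: "F = map (concat \<circ> intervals D) qs" "subseq qs ps" by blast
      have sub: "set qs \<subseteq> set ps" using qs(2) by (rule subseq_set)
      have "b = concat (concat (map (intervals D) qs))"
        unfolding F(3) qs(1) by (induction qs) auto
      also have "concat (map (intervals D) qs) = intervals D (concat qs)"
        using sub even by (subst intervals_concat) auto
      finally have b: "f b = \<phi> (concat qs)" by (simp add: \<phi>_def)
      obtain s where s: "s \<in> subset_sums xs" "length (concat qs) = 2 * s"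
        using length_concat_subseq[OF qs(2) ps(2)] by blast
      have "qs \<noteq> []" using F(1) qs(1) by auto
      then have "concat qs \<noteq> []" using sub even(2) by (cases qs) auto
      then have "length (concat qs) \<noteq> 0" by (simp only: length_0_conv not_False_eq_True)
      then have "s \<noteq> 0" using s(2) by linarith
      have "subseq (concat qs) p"
        using subseq_concat[OF qs(2)] concat_ps by (rule subseq_order.trans)
      moreover have "subseq (take (2 * s) p) p"
        by (intro prefix_imp_subseq take_is_prefix)
      moreover have "s \<le> T" using subset_sums_le[OF s(1)] xs(3) by simp
      ultimately have "\<phi> (concat qs) = \<phi> (take (2 * s) p)"
        using s(2) p(2) by (intro mono) auto
      then show ?thesis using b \<kappa>[OF s(1) \<open>s \<noteq> 0\<close>] by simp
    qed
    show "f b = f b'" if "block_refines [b] E" "block_refines [b'] E" for b b'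
      using col[OF that(1)] col[OF that(2)] by simp
  qed
qed

interpretation milliken_taylor: refinement block_refines finite_unions_bound
proof
  fix D E F G P :: "'a list list" and b and f :: "'a list \<Rightarrow> nat" and m r :: nat
  show "block_refines D D"
    unfolding block_refines_def by (intro exI[of _ "map (\<lambda>x. [x]) D"]) (auto simp: concat_map_singleton comp_def)
  show "block_refines D E \<Longrightarrow> block_refines E F \<Longrightarrow> block_refines D F" by (rule block_refines_trans)
  show "block_refines (D @ E) (F @ G)" if DE: "block_refines D F" "block_refines E G"
  proof -
    obtain Ds Es where "D = map concat Ds" "subseq (concat Ds) F" "[] \<notin> set Ds"
      "E = map concat Es" "subseq (concat Es) G" "[] \<notin> set Es"
      using DE unfolding block_refines_def by (elim exE conjE)
    then show ?thesis
      unfolding block_refines_def by (intro exI[of _ "Ds @ Es"]) (auto intro: list_emb_append_mono)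
  qed
  show "block_refines [] D"
    unfolding block_refines_def by (intro exI[of _ "[]"]) auto
  show "\<exists>F G. D = F @ G \<and> block_refines P F \<and> block_refines [b] G" if P: "block_refines (P @ [b]) D"
  proof -
    obtain Rs where Rs: "P @ [b] = map concat Rs" "subseq (concat Rs) D" "[] \<notin> set Rs"
      using P unfolding block_refines_def by (elim exE conjE)
    then obtain Ps Q where "Rs = Ps @ [Q]" by (cases Rs rule: rev_cases) auto
    with Rs have *: "P = map concat Ps" "b = concat Q" "subseq (concat Ps @ Q) D" "[] \<notin> set Ps" "Q \<noteq> []"
      by auto
    from list_emb_appendD[OF *(3)] obtain F G where "D = F @ G" "subseq (concat Ps) F" "subseq Q G" by blast
    with * show ?thesis
      unfolding block_refines_def by (intro exI[of _ F] exI[of _ G] conjI exI[of _ Ps] exI[of _ "[Q]"]) auto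
  qed
  show "\<not> block_refines [b] []"
    by (auto simp: block_refines_def map_eq_Cons_conv dest: list_emb_Nil2)
  show "finite {P. block_refines P D}" "card {P. block_refines P D} \<le> 3 ^ length D"
    using block_refinements by auto
  show "finite_unions_bound m r \<le> length D \<Longrightarrow> (\<And>b. f b < r) \<Longrightarrow>
    \<exists>E. block_refines E D \<and> length E = m \<and>
      (\<forall>b b'. block_refines [b] E \<longrightarrow> block_refines [b'] E \<longrightarrow> f b = f b')"
    by (rule finite_unions)
qed

section \<open>Composition of Carlson--Simpson sequences\<close>

text \<open>The variable part of \<open>cs_apply\<close>. Zipping truncates to the shorter list, so
  the algebraic laws hold without length conditions until \<open>cs_apply\<close> itself
  enters.\<close>

definition plug :: "'l letter list list \<Rightarrow> 'l letter list \<Rightarrow> 'l letter list" where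
  "plug ws v = concat (map2 subst v ws)"

lemma plug_Nil [simp]: "plug ws [] = []" "plug [] v = []"
  and plug_Cons [simp]: "plug (w # ws) (a # v) = subst a w @ plug ws v"
  by (simp_all add: plug_def)

lemma plug_append: "plug ws (u @ v) = plug ws u @ plug (drop (length u) ws) v"
proof (induction u arbitrary: ws)
  case (Cons a u)
  then show ?case by (cases ws) auto
qed simp

lemma length_plug: "length (plug ws v) \<le> length (concat ws)"
proof (induction ws arbitrary: v)
  case (Cons w ws)
  then show ?case by (cases v) (auto simp: subst_def)
qed simp

lemma cs_apply_eq_plug:
  assumes "length v \<le> length (snd W)"
  shows "cs_apply W v = fst W @ plug (snd W) v"
proof -
  have "map (\<lambda>j. subst (v ! j) (snd W ! j)) [0..<length v] = map2 subst v (snd W)"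
    using assms by (intro nth_equalityI) auto
  then show ?thesis by (simp add: cs_apply_def plug_def)
qed

lemma subst_subst: "subst a (subst b u) = subst (if b = X then a else b) u"
  by (simp add: subst_def)

lemma subst_append: "subst a (u @ v) = subst a u @ subst a v"
  by (simp add: subst_def)

lemma subst_id: "X \<notin> set u \<Longrightarrow> subst a u = u"
  by (auto simp: subst_def intro: map_idI)

lemma subst_plug: "subst a (plug ws v) = plug ws (subst a v)"
proof (induction ws arbitrary: v)
  case (Cons w ws)
  then show ?case
    by (cases v) (auto simp: subst_append subst_subst, simp_all add: subst_def)
qed (simp add: subst_def)

fun plug_blocks :: "'l letter list list \<Rightarrow> 'l letter list list \<Rightarrow> 'l letter list list" where
  "plug_blocks ws [] = []"
| "plug_blocks ws (u # us) = plug ws u # plug_blocks (drop (length u) ws) us"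

lemma length_plug_blocks [simp]: "length (plug_blocks ws us) = length us"
  by (induction ws us rule: plug_blocks.induct) auto

lemma concat_plug_blocks: "concat (plug_blocks ws us) = plug ws (concat us)"
  by (induction ws us rule: plug_blocks.induct) (auto simp: plug_append)

lemma plug_plug_blocks: "plug (plug_blocks ws us) z = plug ws (plug us z)"
proof (induction ws us arbitrary: z rule: plug_blocks.induct)
  case (2 ws u us)
  then show ?case
    by (cases z) (auto simp: plug_append subst_plug, simp add: subst_def)
qed simp

definition cs_compose :: "'l cs_seq \<Rightarrow> 'l cs_seq \<Rightarrow> 'l cs_seq" where
  "cs_compose W U = (fst W @ plug (snd W) (fst U), plug_blocks (drop (length (fst U)) (snd W)) (snd U))"

text \<open>The number of variable words of another sequence that a composition with
  \<open>U\<close> consumes, hence a lower bound on the dimension that sequence must have.\<close>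

definition total_length :: "'l cs_seq \<Rightarrow> nat" where
  "total_length U = length (fst U) + length (concat (snd U))"

lemma length_cs_apply:
  "length z \<le> length (snd U) \<Longrightarrow> length (cs_apply U z) \<le> total_length U"
  using length_plug[of "snd U" z] by (simp add: cs_apply_eq_plug total_length_def)

lemma cs_apply_compose:
  assumes "length z \<le> length (snd U)" "total_length U \<le> length (snd W)"
  shows "cs_apply (cs_compose W U) z = cs_apply W (cs_apply U z)"
proof -
  have "length (cs_apply U z) \<le> length (snd W)"
    using length_cs_apply[OF assms(1)] assms(2) by simp
  then show ?thesis
    using assms(1) by (simp add: cs_apply_eq_plug cs_compose_def plug_append plug_plug_blocks)
qed

lemma total_length_compose: "total_length (cs_compose W U) \<le> total_length W"
proof -
  have "total_length (cs_compose W U) = length (fst W @ plug (snd W) (fst U @ concat (snd U)))"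
    by (simp add: total_length_def cs_compose_def concat_plug_blocks plug_append)
  then show ?thesis
    using length_plug[of "snd W" "fst U @ concat (snd U)"] by (simp add: total_length_def)
qed

text \<open>Carlson--Simpson sequences whose dimension may be zero.\<close>

definition variable_seq :: "nat \<Rightarrow> 'l cs_seq \<Rightarrow> bool" where
  "variable_seq k U \<longleftrightarrow> set (fst U) \<subseteq> digits k \<and> (\<forall>u \<in> set (snd U). left_variable_word k u)"

lemma carlson_simpson_iff:
  "carlson_simpson k n U \<longleftrightarrow> 1 \<le> n \<and> length (snd U) = n \<and> variable_seq k U"
  by (auto simp: carlson_simpson_def variable_seq_def)

lemma set_subst: "set u \<subseteq> B \<union> {X} \<Longrightarrow> a \<in> B \<union> C \<Longrightarrow> set (subst a u) \<subseteq> B \<union> C"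
  by (auto simp: subst_def)

lemma set_plug:
  "\<forall>w \<in> set ws. set w \<subseteq> B \<union> {X} \<Longrightarrow> set v \<subseteq> B \<union> C \<Longrightarrow> set (plug ws v) \<subseteq> B \<union> C"
proof (induction ws arbitrary: v)
  case (Cons w ws)
  show ?case
  proof (cases v)
    case (Cons a v')
    then show ?thesis using Cons.IH[of v'] Cons.prems set_subst[of w B a C] by simp
  qed simp
qed simp

lemma left_variable_word_plug:
  assumes "\<forall>w \<in> set ws. left_variable_word k w" "left_variable_word k u" "ws \<noteq> []"
  shows "left_variable_word k (plug ws u)"
proof -
  obtain w ws' where w: "ws = w # ws'" using assms(3) by (cases ws) auto
  obtain u' where u: "u = X # u'" using assms(2) by (cases u) (auto simp: left_variable_word_def)
  have "set (plug ws u) \<subseteq> digits k \<union> {X}"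
    using assms by (intro set_plug) (auto simp: left_variable_word_def)
  moreover have "plug ws u \<noteq> []" "hd (plug ws u) = X"
    using assms(1) w u by (auto simp: left_variable_word_def subst_def hd_map hd_append)
  ultimately show ?thesis by (simp add: left_variable_word_def)
qed

lemma left_variable_word_plug_blocks:
  assumes "\<forall>w \<in> set ws. left_variable_word k w" "\<forall>u \<in> set us. left_variable_word k u"
    "length (concat us) \<le> length ws"
  shows "\<forall>u \<in> set (plug_blocks ws us). left_variable_word k u"
  using assms
proof (induction ws us rule: plug_blocks.induct)
  case (2 ws u us)
  have "ws \<noteq> []" using "2.prems" by (auto simp: left_variable_word_def)
  then have "left_variable_word k (plug ws u)" using "2.prems" by (intro left_variable_word_plug) auto
  moreover have "\<forall>u \<in> set (plug_blocks (drop (length u) ws) us). left_variable_word k u"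
    using "2.prems" by (intro "2.IH") (auto dest: in_set_dropD)
  ultimately show ?case by simp
qed simp

lemma variable_seq_compose:
  assumes W: "variable_seq k W" and U: "variable_seq k U" "total_length U \<le> length (snd W)"
  shows "variable_seq k (cs_compose W U)"
proof -
  have "set (plug (snd W) (fst U)) \<subseteq> digits k \<union> {}"
    using W U by (intro set_plug) (auto simp: variable_seq_def left_variable_word_def)
  moreover have "\<forall>u \<in> set (plug_blocks (drop (length (fst U)) (snd W)) (snd U)). left_variable_word k u"
    using W U by (intro left_variable_word_plug_blocks)
      (auto simp: variable_seq_def total_length_def dest: in_set_dropD)
  ultimately show ?thesis using W by (simp add: variable_seq_def cs_compose_def)
qed

section \<open>Compositions as Carlson-Simpson subsequences\<close>

lemma plug_eq_concat:
  assumes "length v \<le> length ws"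
  shows "plug ws v = concat (map (\<lambda>j. subst (v ! j) (ws ! j)) [0..<length v])"
proof -
  have "map2 subst v ws = map (\<lambda>j. subst (v ! j) (ws ! j)) [0..<length v]"
    using assms by (intro nth_equalityI) auto
  then show ?thesis by (simp add: plug_def)
qed

lemma plug_segment:
  assumes "i + length u \<le> length ws" "\<And>j. j < length u \<Longrightarrow> a (i + j) = u ! j"
  shows "plug (drop i ws) u = concat (map (\<lambda>j. subst (a j) (ws ! j)) [i..<i + length u])"
proof -
  have "[i..<i + length u] = map ((+) i) [0..<length u]"
    by (rule nth_equalityI) auto
  then have "map (\<lambda>j. subst (a j) (ws ! j)) [i..<i + length u]
      = map (\<lambda>j. subst (u ! j) (drop i ws ! j)) [0..<length u]"
    using assms by simp
  then show ?thesis using assms(1) by (simp add: plug_eq_concat)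
qed

lemma plug_blocks_nth:
  "i < length us \<Longrightarrow>
    plug_blocks ws us ! i = plug (drop (length (concat (take i us))) ws) (us ! i)"
proof (induction ws us arbitrary: i rule: plug_blocks.induct)
  case (2 ws u us)
  then show ?case by (cases i) (auto simp: add.commute)
qed simp

lemma cs_subsequence_compose:
  assumes W: "carlson_simpson k n W" and U: "carlson_simpson k d U" "total_length U \<le> n" and "1 \<le> k"
  shows "cs_subsequence k d (cs_compose W U) W"
proof -
  \<comment> \<open>The witnesses: \<open>U\<close> written out as one word supplies the letters
    \<open>a j\<close>, and \<open>m i\<close> is the position where its i-th variable word starts.
    After the end of that word \<open>Num 1\<close> fills up, an admissible letter since k is
    positive.\<close>
  define l where "l = fst U @ concat (snd U)"
  define a where "a j = (if j < length l then l ! j else Num 1)" for j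
  define m where "m i = length (fst U) + length (concat (take i (snd U)))" for i
  have n: "length (snd W) = n" and d: "length (snd U) = d"
    using W U(1) by (auto simp: carlson_simpson_def)
  have lvw: "left_variable_word k (snd U ! i)" if "i < d" for i
    using U(1) d that by (auto simp: carlson_simpson_def)
  have ll: "length l = total_length U" by (simp add: l_def total_length_def)
  have m_Suc: "m (Suc i) = m i + length (snd U ! i)" if "i < d" for i
    using that d by (simp add: m_def take_Suc_conv_app_nth)
  have m_le: "m i \<le> length l" for i
  proof -
    have "concat (snd U) = concat (take i (snd U)) @ concat (drop i (snd U))"
      by (metis append_take_drop_id concat_append)
    then show ?thesis by (simp add: m_def l_def)
  qed
  have a_m: "a (m i + j) = snd U ! i ! j" if "i < d" "j < length (snd U ! i)" for i j
  proof -
    have *: "snd U = take i (snd U) @ snd U ! i # drop (Suc i) (snd U)"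
      using that(1) d by (simp add: id_take_nth_drop)
    have "l = (fst U @ concat (take i (snd U))) @ snd U ! i @ concat (drop (Suc i) (snd U))"
      unfolding l_def by (subst *) simp
    moreover have "m i = length (fst U @ concat (take i (snd U)))" by (simp add: m_def)
    ultimately have "l ! (m i + j) = snd U ! i ! j" using that(2) by (simp add: nth_append)
    moreover have "m i + j < length l" using m_le[of "Suc i"] m_Suc[OF that(1)] that(2) by simp
    ultimately show ?thesis by (simp add: a_def)
  qed
  have l_set: "set l \<subseteq> digits k \<union> {X}"
    using U(1) by (auto simp: l_def carlson_simpson_def left_variable_word_def)
  show ?thesis
    unfolding cs_subsequence_def
  proof (intro conjI exI[of _ a] exI[of _ m] allI impI)
    show "carlson_simpson k d (cs_compose W U)"
      using W U d n variable_seq_compose[of k W U]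
      by (auto simp: carlson_simpson_iff cs_compose_def)
    have "Num 1 \<in> digits k" using \<open>1 \<le> k\<close> by (auto simp: digits_def)
    then show "a j \<in> digits k \<union> {X}" for j
      using subsetD[OF l_set nth_mem, of j] by (auto simp: a_def)
    show "m i < m (Suc i)" if "i < d" for i
      using m_Suc[OF that] lvw[OF that] by (simp add: left_variable_word_def)
    show "m d \<le> length (snd W)" using m_le[of d] ll U(2) n by simp
    show "a (m i) = X" if "i < d" for i
      using a_m[OF that, of 0] lvw[OF that] by (auto simp: left_variable_word_def hd_conv_nth)
    show "a j \<in> digits k" if "j < m 0" for j
    proof -
      have "a j = fst U ! j" using that by (simp add: a_def l_def m_def nth_append)
      moreover have "fst U ! j \<in> set (fst U)" using that by (simp add: m_def)
      ultimately show ?thesis using U(1) by (auto simp: carlson_simpson_def)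
    qed
    have "plug (drop 0 (snd W)) (fst U)
        = concat (map (\<lambda>j. subst (a j) (snd W ! j)) [0..<0 + length (fst U)])"
      using U(2) n by (intro plug_segment) (auto simp: total_length_def a_def l_def nth_append)
    then show "fst (cs_compose W U) = fst W @ concat (map (\<lambda>j. subst (a j) (snd W ! j)) [0..<m 0])"
      by (simp add: cs_compose_def m_def)
    show "snd (cs_compose W U) ! i = concat (map (\<lambda>j. subst (a j) (snd W ! j)) [m i..<m (Suc i)])"
      if "i < d" for i
    proof -
      have "plug (drop (m i) (snd W)) (snd U ! i)
          = concat (map (\<lambda>j. subst (a j) (snd W ! j)) [m i..<m i + length (snd U ! i)])"
        using m_le[of "Suc i"] m_Suc[OF that] ll U(2) n a_m[OF that] by (intro plug_segment) auto
      moreover have "snd (cs_compose W U) ! i = plug (drop (m i) (snd W)) (snd U ! i)"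
        using that d by (simp add: cs_compose_def plug_blocks_nth m_def add.commute)
      ultimately show ?thesis using m_Suc[OF that] by simp
    qed
  qed
qed

section \<open>Identifying the digits\<close>

lemma card_lists_le:
  assumes "finite A" "card A \<le> K"
  shows "card {z. set z \<subseteq> A \<and> length z \<le> n} \<le> Suc K ^ n"
proof -
  have "(\<Sum>i\<le>n. K ^ i) \<le> Suc K ^ n"
  proof (induction n)
    case (Suc n)
    have "K ^ Suc n \<le> K * Suc K ^ n" 
      unfolding power_Suc by (intro mult_le_mono2 power_mono) auto
    moreover have "(\<Sum>i\<le>Suc n. K ^ i) = (\<Sum>i\<le>n. K ^ i) + K ^ Suc n"
      "Suc K ^ Suc n = Suc K ^ n + K * Suc K ^ n" by simp_all
    ultimately show ?case using Suc by linarith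
  qed simp
  moreover have "(\<Sum>i\<le>n. card A ^ i) \<le> (\<Sum>i\<le>n. K ^ i)"
    using assms(2) by (intro sum_mono power_mono) auto
  ultimately show ?thesis using assms(1) by (simp add: card_lists_length_le)
qed

text \<open>\<open>N\<close> is at least the number of colour vectors over words of length at most
  m, so N + 1 words force a repetition. The inner sequence is chosen first, for vectors over all
  words of length at most N that may precede it.\<close>

fun merge_bound :: "nat \<Rightarrow> nat \<Rightarrow> nat \<Rightarrow> nat" where
  "merge_bound K 0 r = 0"
| "merge_bound K (Suc m) r =
    (let N = r ^ (Suc K ^ m) in N + merge_bound K m (r ^ (Suc K ^ N)))"

text \<open>
  Shelah's pigeonhole argument: two of the \<open>N + 1\<close> words \<open>p\<^sup>b q\<^sup>N\<^sup>-\<^sup>b\<close>, say for \<open>b < b'\<close>, behave in the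
  same way, and then \<open>p\<^sup>b x\<^sup>b\<^sup>'\<^sup>-\<^sup>b q\<^sup>N\<^sup>-\<^sup>b\<^sup>'\<close> does not distinguish \<open>p\<close> from \<open>q\<close>.
\<close>

lemma merge_two_digits:
  fixes c :: "'l letter list \<Rightarrow> nat"
  assumes "p \<in> digits k" "q \<in> digits k" "finite A" "card A \<le> K" "digits k \<subseteq> A" "\<And>u. c u < r"
  shows "\<exists>U. variable_seq k U \<and> length (snd U) = m \<and> total_length U \<le> merge_bound K m r \<and>
    (\<forall>z z'. set z \<subseteq> A \<longrightarrow> set z' \<subseteq> A \<longrightarrow> length z \<le> m \<longrightarrow>
      map (id(p := q)) z = map (id(p := q)) z' \<longrightarrow> c (cs_apply U z) = c (cs_apply U z'))"
  using assms(6)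
proof (induction m arbitrary: c r)
  case 0
  show ?case by (rule exI[of _ "([], [])"]) (auto simp: variable_seq_def total_length_def)
next
  case (Suc m)
  define N where "N = r ^ (Suc K ^ m)"
  define S where "S n = {z. set z \<subseteq> A \<and> length z \<le> n}" for n
  have S: "finite (S n)" "card (S n) \<le> Suc K ^ n" for n
    unfolding S_def using finite_lists_length_le[OF assms(3)] card_lists_le[OF assms(3,4)] by auto
  have r: "0 < r" using Suc.prems[of "[]"] by simp
  \<comment> \<open>\<open>e\<^sub>1\<close> codes the behaviour of a word behind every front of
    length at most N, \<open>e\<^sub>2\<close> the behaviour of a front before every continuation by
    \<open>U\<close>.\<close>
  obtain e\<^sub>1 where e\<^sub>1: "\<And>h. (\<And>x. h x < r) \<Longrightarrow> e\<^sub>1 h < r ^ (Suc K ^ N)"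
    "\<And>h h' x. (\<And>x. h x < r) \<Longrightarrow> (\<And>x. h' x < r) \<Longrightarrow> e\<^sub>1 h = e\<^sub>1 h' \<Longrightarrow> x \<in> S N \<Longrightarrow> h x = h' x"
    using vector_code[OF S r] by blast
  obtain e\<^sub>2 where e\<^sub>2: "\<And>h. (\<And>x. h x < r) \<Longrightarrow> e\<^sub>2 h < N"
    "\<And>h h' x. (\<And>x. h x < r) \<Longrightarrow> (\<And>x. h' x < r) \<Longrightarrow> e\<^sub>2 h = e\<^sub>2 h' \<Longrightarrow> x \<in> S m \<Longrightarrow> h x = h' x"
    using vector_code[OF S r, of m] unfolding N_def by blast
  let ?\<sigma> = "map (id(p := q))"
  obtain U where U: "variable_seq k U" "length (snd U) = m"
    "total_length U \<le> merge_bound K m (r ^ (Suc K ^ N))" and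
    inv: "\<And>z z'. set z \<subseteq> A \<Longrightarrow> set z' \<subseteq> A \<Longrightarrow> length z \<le> m \<Longrightarrow> ?\<sigma> z = ?\<sigma> z' \<Longrightarrow>
      e\<^sub>1 (\<lambda>s. c (s @ cs_apply U z)) = e\<^sub>1 (\<lambda>s. c (s @ cs_apply U z'))"
    using Suc.IH[of "\<lambda>u. e\<^sub>1 (\<lambda>s. c (s @ u))", OF e\<^sub>1(1)[OF Suc.prems]] by blast
  have in_context: "c (s @ cs_apply U z) = c (s @ cs_apply U z')"
    if "s \<in> S N" "set z \<subseteq> A" "set z' \<subseteq> A" "length z \<le> m" "?\<sigma> z = ?\<sigma> z'" for s z z'
    using e\<^sub>1(2)[OF Suc.prems Suc.prems inv[OF that(2-5)] that(1)] .
  define g where "g b = e\<^sub>2 (\<lambda>z. c (replicate b p @ replicate (N - b) q @ cs_apply U z))" for b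
  have "g ` {..N} \<subseteq> {..<N}" using e\<^sub>2(1) Suc.prems by (auto simp: g_def)
  then have "card (g ` {..N}) < card {..N}" using card_mono[of "{..<N}" "g ` {..N}"] by simp
  then have "\<not> inj_on g {..N}" by (rule pigeonhole)
  then obtain x y where xy: "x \<noteq> y" "x \<le> N" "y \<le> N" "g x = g y"
    by (auto simp: inj_on_def)
  then obtain b b' where b: "b < b'" "b' \<le> N" "g b = g b'"
    by (cases "x < y") (metis, metis linorder_neqE_nat)
  have same: "c (replicate b p @ replicate (N - b) q @ cs_apply U z)
      = c (replicate b' p @ replicate (N - b') q @ cs_apply U z)" if "z \<in> S m" for z
    using e\<^sub>2(2)[OF Suc.prems Suc.prems b(3)[unfolded g_def] that] .
  have XU: "X \<notin> set (fst U)" "q \<noteq> X" "p \<in> A" "q \<in> A"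
    using U(1) assms(1,2,5) by (auto simp: variable_seq_def digits_def)
  \<comment> \<open>The first variable word starts with b' - b \<ge> 1 variables. Up to
    \<open>fst U\<close> a word of \<open>V\<close> that uses this variable word has a front of
    length exactly N, one of those coded above.\<close>
  define V where "V = (replicate b p, (replicate (b' - b) X @ replicate (N - b') q @ fst U) # snd U)"
  have V_Nil: "cs_apply V [] = replicate b p" by (simp add: cs_apply_def V_def)
  have V_Cons: "cs_apply V (a # z) = (replicate b p @ replicate (b' - b) a @ replicate (N - b') q) @ cs_apply U z"
    if "length z \<le> m" for a z
    using that U(2) XU(1,2) by (simp add: cs_apply_eq_plug V_def subst_append subst_id) (simp add: subst_def)
  have V_pq: "c (cs_apply V (a # z)) = c (replicate b p @ replicate (N - b) q @ cs_apply U z)"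
    if "a = p \<or> a = q" "z \<in> S m" for a z
  proof -
    have z: "length z \<le> m" using that(2) by (simp add: S_def)
    have "replicate b p @ replicate (b' - b) p = replicate b' p"
      "replicate (b' - b) q @ replicate (N - b') q = replicate (N - b) q"
      using b by (simp_all flip: replicate_add)
    then have "cs_apply V (p # z) = replicate b' p @ replicate (N - b') q @ cs_apply U z"
      "cs_apply V (q # z) = replicate b p @ replicate (N - b) q @ cs_apply U z"
      unfolding V_Cons[OF z] by (metis append_assoc)+
    then show ?thesis using that same by auto
  qed
  show ?case
  proof (intro exI[of _ V] conjI allI impI)
    show "variable_seq k V"
      using U(1) assms(1,2) b(1) by (auto simp: variable_seq_def V_def left_variable_word_def hd_append)
    show "length (snd V) = Suc m" using U(2) by (simp add: V_def)
    have "total_length V = N + total_length U"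
      using b by (simp add: total_length_def V_def)
    then show "total_length V \<le> merge_bound K (Suc m) r" using U(3) by (simp add: N_def Let_def)
    fix z z'
    assume z: "set z \<subseteq> A" "set z' \<subseteq> A" "length z \<le> Suc m" "?\<sigma> z = ?\<sigma> z'"
    show "c (cs_apply V z) = c (cs_apply V z')"
    proof (cases z)
      case Nil
      then show ?thesis using z by simp
    next
      case (Cons a t)
      then obtain a' t' where z': "z' = a' # t'" using z(4) by (cases z') auto
      have t: "set t \<subseteq> A" "set t' \<subseteq> A" "length t \<le> m" "?\<sigma> t = ?\<sigma> t'" "(id(p := q)) a = (id(p := q)) a'"
        "a \<in> A"
        using z Cons z' by auto
      have t': "length t' \<le> m" "t' \<in> S m"
        using map_eq_imp_length_eq[OF t(4)] t(2,3) by (auto simp: S_def)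
      have "replicate b p @ replicate (b' - b) a @ replicate (N - b') q \<in> S N"
        using b t(6) XU by (auto simp: S_def)
      \<comment> \<open>The tails are exchanged first, behind a fixed front; afterwards the heads,
        which can differ only if they are \<open>p\<close> and \<open>q\<close>.\<close>
      then have "c (cs_apply V (a # t)) = c (cs_apply V (a # t'))"
        unfolding V_Cons[OF t(3)] V_Cons[OF t'(1)] using t(1-4) by (rule in_context)
      moreover have "c (cs_apply V (a # t')) = c (cs_apply V (a' # t'))"
      proof (cases "a = a'")
        case False
        then have "a = p \<or> a = q" "a' = p \<or> a' = q" using t(5) by (auto split: if_splits)
        then show ?thesis using V_pq t'(2) by simp
      qed simp
      ultimately show ?thesis using Cons z' by simp
    qed
  qed
qed

section \<open>Identifying all digits with 1\<close>

definition identify :: "nat \<Rightarrow> 'l letter \<Rightarrow> 'l letter" where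
  "identify j b = (if b \<in> digits j then Num 1 else b)"

lemma map_subst_cong:
  assumes "f a = f a'"
  shows "map f (subst a u) = map f (subst a' u)"
  using assms by (simp add: subst_def)

lemma map_plug_cong:
  "map f v = map f v' \<Longrightarrow> map f (plug ws v) = map f (plug ws v')"
proof (induction ws arbitrary: v v')
  case (Cons w ws)
  show ?case
  proof (cases v)
    case Nil
    then show ?thesis using Cons.prems by simp
  next
    case (Cons a t)
    then obtain a' t' where "v' = a' # t'" "f a = f a'" "map f t = map f t'"
      using Cons.prems by (cases v') auto
    then show ?thesis using Cons Cons.IH[of t t'] map_subst_cong[of f a a' w] by simp
  qed
qed simp

fun identify_bound :: "nat \<Rightarrow> nat \<Rightarrow> nat \<Rightarrow> nat \<Rightarrow> nat" where
  "identify_bound K r 0 m = m"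
| "identify_bound K r (Suc j) m = identify_bound K r j (merge_bound K m r)"

lemma set_cs_apply:
  assumes "variable_seq k U" "digits k \<subseteq> A" "set z \<subseteq> A" "length z \<le> length (snd U)"
  shows "set (cs_apply U z) \<subseteq> A"
proof -
  have "set (plug (snd U) z) \<subseteq> digits k \<union> A"
    using assms by (intro set_plug) (auto simp: variable_seq_def left_variable_word_def)
  then show ?thesis using assms by (auto simp: cs_apply_eq_plug variable_seq_def)
qed

text \<open>In the induction step the outer sequence identifies the digits 1 to j + 1 and the inner
  one adds j + 2, so j merges serve j + 1 digits. The outer identification survives the inner
  substitution by \<open>map_plug_cong\<close>.\<close>

lemma identify_digits:
  fixes c :: "'l letter list \<Rightarrow> nat"
  assumes A: "finite A" "card A \<le> K" "digits k \<subseteq> A" and c: "\<And>u. c u < r" and "j < k"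
  shows "\<exists>U. variable_seq k U \<and> length (snd U) = m \<and> total_length U \<le> identify_bound K r j m \<and>
    (\<forall>z z'. set z \<subseteq> A \<longrightarrow> set z' \<subseteq> A \<longrightarrow> length z \<le> m \<longrightarrow>
      map (identify (Suc j)) z = map (identify (Suc j)) z' \<longrightarrow> c (cs_apply U z) = c (cs_apply U z'))"
  using \<open>j < k\<close>
proof (induction j arbitrary: m)
  case 0
  have "identify (Suc 0) = (id :: 'l letter \<Rightarrow> _)"
    by (auto simp: identify_def digits_def fun_eq_iff)
  then show ?case
    by (intro exI[of _ "([], replicate m [X])"])
      (auto simp: variable_seq_def total_length_def left_variable_word_def concat_replicate_single)
next
  case (Suc j)
  let ?m = "merge_bound K m r"
  let ?\<rho> = "identify (Suc j)" and ?\<sigma> = "id(Num (Suc (Suc j)) := Num 1)"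
  obtain U where U: "variable_seq k U" "length (snd U) = ?m" "total_length U \<le> identify_bound K r j ?m"
    and inv: "\<And>z z'. set z \<subseteq> A \<Longrightarrow> set z' \<subseteq> A \<Longrightarrow> length z \<le> ?m \<Longrightarrow> map ?\<rho> z = map ?\<rho> z' \<Longrightarrow>
      c (cs_apply U z) = c (cs_apply U z')"
    using Suc.IH[of ?m] Suc.prems by auto
  have digits: "Num (Suc (Suc j)) \<in> digits k" "Num 1 \<in> digits k"
    using Suc.prems by (auto simp: digits_def)
  obtain V where V: "variable_seq k V" "length (snd V) = m" "total_length V \<le> ?m"
    and inv': "\<And>z z'. set z \<subseteq> A \<Longrightarrow> set z' \<subseteq> A \<Longrightarrow> length z \<le> m \<Longrightarrow> map ?\<sigma> z = map ?\<sigma> z' \<Longrightarrow>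
      c (cs_apply U (cs_apply V z)) = c (cs_apply U (cs_apply V z'))"
    using merge_two_digits[OF digits A, of "\<lambda>u. c (cs_apply U u)" r m, OF c] by blast
  have le: "total_length V \<le> length (snd U)" using U V by simp
  have comp: "cs_apply (cs_compose U V) z = cs_apply U (cs_apply V z)" if "length z \<le> m" for z
    using cs_apply_compose[OF _ le] that V(2) by simp
  have \<rho>: "?\<rho> b \<in> A" if "b \<in> A" for b
    using that digits(2) A(3) by (auto simp: identify_def)
  \<comment> \<open>Digits up to j + 1 are replaced by 1 thanks to \<open>U\<close>, then the digit
    j + 2 thanks to \<open>V\<close>; together this is
    \<open>identify (Suc (Suc j))\<close>.\<close>
  have reduce: "c (cs_apply U (cs_apply V z)) = c (cs_apply U (cs_apply V (map ?\<sigma> (map ?\<rho> z))))"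
    if z: "set z \<subseteq> A" "length z \<le> m" for z
  proof -
    have set: "set (map ?\<rho> z) \<subseteq> A" "set (map ?\<sigma> (map ?\<rho> z)) \<subseteq> A"
      using z(1) \<rho> digits(2) A(3) by auto
    have "?\<rho> (?\<rho> b) = ?\<rho> b" for b :: "'l letter" by (auto simp: identify_def digits_def)
    then have "map ?\<rho> (cs_apply V z) = map ?\<rho> (cs_apply V (map ?\<rho> z))"
      using z(2) V(2) map_plug_cong[of ?\<rho> z "map ?\<rho> z" "snd V"] by (simp add: cs_apply_eq_plug)
    moreover have "length (cs_apply V z) \<le> ?m" using length_cs_apply[of z V] z(2) V by simp
    ultimately have "c (cs_apply U (cs_apply V z)) = c (cs_apply U (cs_apply V (map ?\<rho> z)))"
      using set_cs_apply[OF V(1) A(3) z(1)] set_cs_apply[OF V(1) A(3) set(1)] z(2) V(2) U(2)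
      by (intro inv) auto
    also have "\<dots> = c (cs_apply U (cs_apply V (map ?\<sigma> (map ?\<rho> z))))"
      using set z(2) by (intro inv') auto
    finally show ?thesis .
  qed
  have \<sigma>\<rho>: "?\<sigma> (?\<rho> b) = identify (Suc (Suc j)) b" for b :: "'l letter"
  proof -
    have "digits (Suc (Suc j)) = insert (Num (Suc (Suc j)) :: 'l letter) (digits (Suc j))"
      by (simp add: digits_def atLeastAtMostSuc_conv)
    then show ?thesis by (auto simp: identify_def)
  qed
  show ?case
  proof (intro exI[of _ "cs_compose U V"] conjI allI impI)
    show "variable_seq k (cs_compose U V)" by (rule variable_seq_compose[OF U(1) V(1) le])
    show "length (snd (cs_compose U V)) = m" using V(2) by (simp add: cs_compose_def)
    show "total_length (cs_compose U V) \<le> identify_bound K r (Suc j) m"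
      using total_length_compose[of U V] U(3) by simp
    fix z z'
    assume z: "set z \<subseteq> A" "set z' \<subseteq> A" "length z \<le> m"
      "map (identify (Suc (Suc j))) z = map (identify (Suc (Suc j))) z'"
    then have "length z' \<le> m" using map_eq_imp_length_eq by metis
    moreover have "map ?\<sigma> (map ?\<rho> z) = map ?\<sigma> (map ?\<rho> z')"
      using z(4) unfolding map_map comp_def \<sigma>\<rho> .
    ultimately show "c (cs_apply (cs_compose U V) z) = c (cs_apply (cs_compose U V) z')"
      using comp reduce z by metis
  qed
qed

section \<open>Words determined by block sequences\<close>

text \<open>A word as a function of position. Outside all blocks stands \<open>Num 1\<close>, the
  digit with which all digits get identified.\<close>

primrec letter_at :: "('l letter \<times> nat list) list \<Rightarrow> nat \<Rightarrow> 'l letter" where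
  "letter_at [] i = Num 1"
| "letter_at (p # ps) i = (if i \<in> set (snd p) then fst p else letter_at ps i)"

lemma letter_at_notin: "\<forall>p \<in> set ps. i \<notin> set (snd p) \<Longrightarrow> letter_at ps i = Num 1"
  by (induction ps) auto

lemma letter_at_zip:
  assumes "j < length z" "length z \<le> length D" "\<And>j'. j' < length z \<Longrightarrow> i \<in> set (D ! j') \<Longrightarrow> j' = j"
  shows "letter_at (zip z D) i = (if i \<in> set (D ! j) then z ! j else Num 1)"
  using assms
proof (induction z arbitrary: j D)
  case (Cons a z)
  obtain B D' where D: "D = B # D'" using Cons.prems(2) by (cases D) auto
  show ?case
  proof (cases j)
    case 0
    have "i \<notin> set E" if "(b, E) \<in> set (zip z D')" for b E
    proof
      assume i: "i \<in> set E"
      from that obtain n where n: "n < length z" "D' ! n = E" by (auto simp: in_set_zip)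
      then show False using Cons.prems(3)[of "Suc n"] i D 0 by simp
    qed
    then have "letter_at (zip z D') i = Num 1" by (intro letter_at_notin) auto
    then show ?thesis using D 0 by simp
  next
    case (Suc j')
    have "i \<notin> set B" using Cons.prems(3)[of 0] D Suc by auto
    moreover have "letter_at (zip z D') i = (if i \<in> set (D' ! j') then z ! j' else Num 1)"
    proof (rule Cons.IH)
      fix n assume "n < length z" "i \<in> set (D' ! n)"
      then show "n = j'" using Cons.prems(3)[of "Suc n"] D Suc by simp
    qed (use Cons.prems D Suc in auto)
    ultimately show ?thesis using D Suc by simp
  qed
qed simp

text \<open>After identification a block filled with a digit looks like the background. Disjointness
  ensures that removing it uncovers no later block at the same position.\<close>

lemma letter_at_filter_digits:
  assumes "1 \<le> k" "sorted_wrt (\<lambda>p q. set (snd p) \<inter> set (snd q) = {}) ps"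
  shows "identify k (letter_at ps i) = letter_at (filter (\<lambda>p. fst p \<notin> digits k) ps) i"
  using assms(2)
proof (induction ps)
  case Nil
  then show ?case by (simp add: identify_def)
next
  case (Cons p ps)
  show ?case
  proof (cases "i \<in> set (snd p) \<and> fst p \<in> digits k")
    case True
    then have "letter_at (filter (\<lambda>p. fst p \<notin> digits k) ps) i = Num 1"
      using Cons.prems by (intro letter_at_notin) fastforce
    then show ?thesis using True by (simp add: identify_def)
  next
    case False
    then show ?thesis using Cons by (auto simp: identify_def)
  qed
qed

text \<open>The counterpart of \<open>remdups_adj\<close> on blocks: a run of equal letters is
  carried by the union of its blocks. Once the digits are removed, this leaves one block for each
  letter of the type.\<close>

fun collapse :: "('a \<times> 'b list) list \<Rightarrow> ('a \<times> 'b list) list" where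
  "collapse ((a, E) # (b, F) # ps) =
    (if a = b then collapse ((a, E @ F) # ps) else (a, E) # collapse ((b, F) # ps))"
| "collapse ps = ps"

lemma map_fst_collapse: "map fst (collapse ps) = remdups_adj (map fst ps)"
  by (induction ps rule: collapse.induct) auto

lemma letter_at_collapse: "letter_at (collapse ps) i = letter_at ps i"
  by (induction ps rule: collapse.induct) auto

lemma block_refines_collapse: "block_refines (map snd (collapse ps)) (map snd ps)"
proof (induction ps rule: collapse.induct)
  case (1 a E b F ps)
  show ?case
  proof (cases "a = b")
    case True
    have "block_refines [E @ F] [E, F]"
      unfolding block_refines_def by (intro exI[of _ "[[E, F]]"]) auto
    then have "block_refines ((E @ F) # map snd ps) (E # F # map snd ps)"
      using milliken_taylor.append[OF _ milliken_taylor.refl, of "[E @ F]" "[E, F]"] by simp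
    then show ?thesis using 1(1) True milliken_taylor.trans by auto
  next
    case False
    then show ?thesis using 1(2) milliken_taylor.Cons by auto
  qed
qed (auto intro: milliken_taylor.refl)

lemma subseq_imp_block_refines: "subseq D E \<Longrightarrow> block_refines D E"
  unfolding block_refines_def by (intro exI[of _ "map (\<lambda>x. [x]) D"]) (auto simp: comp_def)

lemma remdups_adj_replicate_append:
  "0 < n \<Longrightarrow> remdups_adj (replicate n a @ xs) = remdups_adj (a # xs)"
proof (induction n)
  case (Suc n)
  then show ?case by (cases n) auto
qed simp

lemma remdups_adj_Cons_cong:
  "remdups_adj xs = remdups_adj ys \<Longrightarrow> remdups_adj (a # xs) = remdups_adj (a # ys)"
  by (simp add: remdups_adj_Cons)

text \<open>A digit turns a left variable word into a word over the digits; another letter leaves,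
  apart from digits, a nonempty run of that letter, since the word starts with the variable.\<close>

lemma word_type_plug:
  assumes "\<forall>w \<in> set ws. left_variable_word k w" "length v \<le> length ws"
  shows "word_type k (plug ws v) = word_type k v"
  using assms
proof (induction ws arbitrary: v)
  case (Cons w ws)
  show ?case
  proof (cases v)
    case (Cons a v')
    obtain w' where w: "w = X # w'" "set w' \<subseteq> digits k \<union> {X}"
      using Cons.prems(1) by (cases w) (auto simp: left_variable_word_def)
    let ?f = "filter (\<lambda>a. a \<notin> digits k)"
    have IH: "remdups_adj (?f (plug ws v')) = remdups_adj (?f v')"
      using Cons.IH[of v'] Cons.prems Cons by (simp add: word_type_def)
    show ?thesis
    proof (cases "a \<in> digits k")
      case True
      then have "?f (subst a w) = []" using w by (auto simp: subst_def filter_empty_conv)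
      then show ?thesis using IH True Cons by (simp add: word_type_def)
    next
      case False
      have "\<forall>b \<in> set (?f (subst a w)). b = a" using w by (auto simp: subst_def)
      then have "?f (subst a w) = replicate (length (?f (subst a w))) a"
        by (simp add: replicate_length_same)
      moreover have "0 < length (?f (subst a w))" using False w(1) by (simp add: subst_def)
      ultimately have "remdups_adj (?f (subst a w) @ ?f (plug ws v')) = remdups_adj (a # ?f (plug ws v'))"
        using remdups_adj_replicate_append by metis
      then show ?thesis using remdups_adj_Cons_cong[OF IH] False Cons by (simp add: word_type_def)
    qed
  qed simp
qed simp

lemma word_type_cs_apply:
  assumes "variable_seq k V" "length z \<le> length (snd V)"
  shows "word_type k (cs_apply V z) = word_type k z"
proof -
  have "filter (\<lambda>a. a \<notin> digits k) (fst V) = []"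
    using assms(1) by (auto simp: variable_seq_def filter_empty_conv)
  then show ?thesis
    using assms word_type_plug[of "snd V" k z]
    by (simp add: cs_apply_eq_plug word_type_def variable_seq_def)
qed

lemma total_length_eq_cs_apply:
  assumes "length z = length (snd U)"
  shows "total_length U = length (cs_apply U z)"
proof -
  have "length (plug ws z) = length (concat ws)" if "length z = length ws"
    for z :: "'a letter list" and ws
    using that by (induction z ws rule: list_induct2) (auto simp: subst_def)
  then show ?thesis using assms by (simp add: total_length_def cs_apply_eq_plug)
qed

text \<open>The j-th variable word covers the positions from the minimum of block j to just before
  the minimum of block j + 1; starting at a minimum makes it a left variable word. The last block
  contributes only its minimum, as the end of the last word.\<close>

definition block_word_seq :: "nat list list \<Rightarrow> 'l cs_seq" where
  "block_word_seq D = (replicate (hd (D ! 0)) (Num 1),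
     map (\<lambda>j. map (\<lambda>i. if i \<in> set (D ! j) then X else Num 1) [hd (D ! j)..<hd (D ! Suc j)])
       [0..<length D - 1])"

locale block_sequence =
  fixes D :: "nat list list"
  assumes nonempty: "[] \<notin> set D" and sorted: "sorted_wrt (<) (concat D)"
begin

lemma less_of_less_index:
  "i < j \<Longrightarrow> j < length D \<Longrightarrow> x \<in> set (D ! i) \<Longrightarrow> y \<in> set (D ! j) \<Longrightarrow> x < y"
  using sorted
proof (induction D arbitrary: i j)
  case (Cons B D)
  then obtain j' where j: "j = Suc j'" by (cases j) auto
  show ?case
  proof (cases i)
    case 0
    then show ?thesis using Cons.prems j nth_mem[of j' D] by (auto simp: sorted_wrt_append simp del: nth_mem)
  next
    case (Suc i')
    then show ?thesis using Cons.prems Cons.IH[of i' j'] j by (auto simp: sorted_wrt_append)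
  qed
qed simp

lemma hd_in: "j < length D \<Longrightarrow> hd (D ! j) \<in> set (D ! j)"
  using nonempty by (metis hd_in_set nth_mem)

lemma hd_le: "j < length D \<Longrightarrow> x \<in> set (D ! j) \<Longrightarrow> hd (D ! j) \<le> x"
proof -
  assume j: "j < length D" and x: "x \<in> set (D ! j)"
  have "sorted_wrt (<) (D ! j)"
    using subseq_sorted_wrt[OF subseq_concat[of "[D ! j]" D] sorted] j by (simp add: subseq_singleton_left)
  then show ?thesis using x by (cases "D ! j") auto
qed

lemma hd_less: "i < j \<Longrightarrow> j < length D \<Longrightarrow> hd (D ! i) < hd (D ! j)"
  using less_of_less_index[of i j] hd_in[of i] hd_in[of j] by simp

lemma index_eq:
  assumes "Suc j < length D" "hd (D ! j) \<le> i" "i < hd (D ! Suc j)" "j' < length D" "i \<in> set (D ! j')"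
  shows "j' = j"
proof (rule ccontr)
  assume "j' \<noteq> j"
  then consider "j' < j" | "j' = Suc j" | "Suc j < j'" by linarith
  then show False
  proof cases
    case 1
    then show ?thesis using less_of_less_index[of j' j i "hd (D ! j)"] hd_in[of j] assms by auto
  next
    case 2
    then show ?thesis using hd_le[of j' i] assms by auto
  next
    case 3
    then show ?thesis using less_of_less_index[of "Suc j" j' "hd (D ! Suc j)" i] hd_in[of "Suc j"] assms by auto
  qed
qed

text \<open>Between consecutive minima only one block is present, so the letters can be read off
  from the blocks. The word ends at the minimum of the first block that \<open>z\<close> leaves
  free, hence \<open>z\<close> has to be shorter than \<open>D\<close>.\<close>

lemma cs_apply_block_word_seq:
  assumes "length z < length D"
  shows "cs_apply (block_word_seq D) z = map (letter_at (zip z D)) [0..<hd (D ! length z)]"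
proof -
  let ?u = "\<lambda>j. map (\<lambda>i. if i \<in> set (D ! j) then z ! j else Num 1) [hd (D ! j)..<hd (D ! Suc j)]"
  have "concat (map ?u [0..<m]) = map (letter_at (zip z D)) [hd (D ! 0)..<hd (D ! m)]"
    if "m \<le> length z" for m
    using that
  proof (induction m)
    case (Suc m)
    have "?u m = map (letter_at (zip z D)) [hd (D ! m)..<hd (D ! Suc m)]"
    proof (intro map_cong refl)
      fix i assume "i \<in> set [hd (D ! m)..<hd (D ! Suc m)]"
      then show "(if i \<in> set (D ! m) then z ! m else Num 1) = letter_at (zip z D) i"
        using Suc.prems assms index_eq[of m i] by (intro letter_at_zip[symmetric]) auto
    qed
    moreover have "[hd (D ! 0)..<hd (D ! Suc m)] = [hd (D ! 0)..<hd (D ! m)] @ [hd (D ! m)..<hd (D ! Suc m)]"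
    proof -
      have "hd (D ! 0) \<le> hd (D ! m)" using hd_less[of 0 m] Suc.prems assms by (cases m) auto
      moreover have "hd (D ! m) \<le> hd (D ! Suc m)" using hd_less[of m "Suc m"] Suc.prems assms by auto
      ultimately show ?thesis by (metis le_add_diff_inverse upt_add_eq_append)
    qed
    ultimately show ?case using Suc by simp
  qed simp
  from this[OF order_refl] have body: "concat (map ?u [0..<length z])
      = map (letter_at (zip z D)) [hd (D ! 0)..<hd (D ! length z)]" .
  have "letter_at (zip z D) i = Num 1" if i: "i < hd (D ! 0)" for i
  proof (rule letter_at_notin, rule ballI)
    fix p assume "p \<in> set (zip z D)"
    then obtain n where n: "n < length D" "snd p = D ! n" by (auto simp: in_set_zip)
    then have "0 < length D" by linarith
    then have "hd (D ! 0) \<le> x" if "x \<in> set (D ! n)" for x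
      using less_of_less_index[of 0 n "hd (D ! 0)" x] hd_in[of 0] hd_le[of 0 x] n(1) that
      by (cases n) auto
    then show "i \<notin> set (snd p)" using n(2) i by fastforce
  qed
  then have prefix: "replicate (hd (D ! 0)) (Num 1) = map (letter_at (zip z D)) [0..<hd (D ! 0)]"
    by (intro nth_equalityI) auto
  have "hd (D ! 0) \<le> hd (D ! length z)" using hd_less[of 0 "length z"] assms by (cases z) auto
  then have upt: "[0..<hd (D ! length z)] = [0..<hd (D ! 0)] @ [hd (D ! 0)..<hd (D ! length z)]"
    using upt_add_eq_append[of 0 "hd (D ! 0)"] by (metis le0 le_add_diff_inverse)
  have blocks: "map (\<lambda>j. subst (z ! j) (snd (block_word_seq D) ! j)) [0..<length z] = map ?u [0..<length z]"
    using assms by (intro map_cong refl) (auto simp: block_word_seq_def subst_def)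
  show ?thesis
    unfolding cs_apply_def blocks body upt map_append prefix[symmetric]
    by (simp add: block_word_seq_def)
qed

lemma variable_block_word_seq:
  assumes "1 \<le> k"
  shows "variable_seq k (block_word_seq D)"
proof -
  have 1: "Num 1 \<in> digits k" using assms by (auto simp: digits_def)
  have "left_variable_word k (map (\<lambda>i. if i \<in> set (D ! j) then X else Num 1) [hd (D ! j)..<hd (D ! Suc j)])"
    if "j < length D - 1" for j
    using hd_less[of j "Suc j"] hd_in[of j] that 1
    by (simp add: left_variable_word_def less_diff_conv upt_conv_Cons image_subset_iff) auto
  with 1 show ?thesis by (auto simp: variable_seq_def block_word_seq_def)
qed

lemma total_length_block_word_seq:
  assumes "D \<noteq> []"
  shows "total_length (block_word_seq D :: 'l cs_seq) = hd (last D)"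
proof -
  let ?z = "replicate (length D - 1) (Num 1) :: 'l letter list"
  have "total_length (block_word_seq D :: 'l cs_seq) = length (cs_apply (block_word_seq D) ?z)"
    by (simp add: total_length_eq_cs_apply block_word_seq_def)
  then show ?thesis
    using assms by (simp add: cs_apply_block_word_seq last_conv_nth)
qed

end

lemma block_sequence_singletons:
  assumes "block_refines D (map (\<lambda>i. [i]) [0..<M])"
  shows "block_sequence D" "\<forall>x \<in> set (concat D). x < M"
proof -
  obtain Ds where Ds: "D = map concat Ds" "subseq (concat Ds) (map (\<lambda>i. [i]) [0..<M])" "[] \<notin> set Ds"
    using assms unfolding block_refines_def by (elim exE conjE)
  have "subseq (concat (concat Ds)) (concat (map (\<lambda>i. [i]) [0..<M]))" by (rule subseq_concat[OF Ds(2)])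
  then have sub: "subseq (concat D) [0..<M]"
    unfolding Ds(1) concat_map_concat by (simp add: concat_map_singleton)
  show "\<forall>x \<in> set (concat D). x < M" using subseq_set[OF sub] by auto
  show "block_sequence D"
  proof
    show "sorted_wrt (<) (concat D)" using sub sorted_wrt_upt by (rule subseq_sorted_wrt)
    have "concat B \<noteq> []" if B: "B \<in> set Ds" for B
    proof -
      have "B \<noteq> []" using B Ds(3) by metis
      then obtain x B' where x: "B = x # B'" by (cases B) auto
      then have "x \<in> set B" by simp
      then have "x \<in> set (concat Ds)" using B by auto
      then have "x \<in> set (map (\<lambda>i. [i]) [0..<M])" using subseq_set[OF Ds(2)] by blast
      then show ?thesis using x by auto
    qed
    then show "[] \<notin> set D" unfolding Ds(1) set_map by (metis imageE)
  qed
qed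

text \<open>A word with at most d letters has at most d runs, and one more block marks the length,
  hence \<open>Suc d\<close>. The colours are vectors indexed by sequences of at most d of the q
  letters.\<close>

definition FK_dim :: "nat \<Rightarrow> nat \<Rightarrow> nat \<Rightarrow> nat" where
  "FK_dim q d r = tuple_bound finite_unions_bound (Suc d) (Suc d) (r ^ (Suc q ^ d))"

definition FK_bound :: "nat \<Rightarrow> nat \<Rightarrow> nat \<Rightarrow> nat \<Rightarrow> nat" where
  "FK_bound k q d r = identify_bound (k + q) r (k - 1) (FK_dim q d r)"

text \<open>
  Once the digits are identified, a word of type \<open>(\<tau>\<^sub>1, \<dots>, \<tau>\<^sub>s)\<close> is given by the sets \<open>E\<^sub>1 < \<dots> < E\<^sub>s\<close> of the
  positions that carry the letters of its successive runs and by its length. The length is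
  recorded as the minimum of a further set \<open>E\<^sub>s\<^sub>+\<^sub>1\<close>.
\<close>

lemma ex_type_homogeneous:
  fixes c :: "'l letter list \<Rightarrow> nat" and L :: "'l letter set"
  assumes k: "1 \<le> k" and d: "1 \<le> d" and L: "finite L" "card L = q" "L \<inter> digits k = {}" and c: "\<And>u. c u < r"
  obtains V where "carlson_simpson k d V" "total_length V \<le> FK_bound k q d r"
    "\<And>z z'. set z \<subseteq> digits k \<union> L \<Longrightarrow> set z' \<subseteq> digits k \<union> L \<Longrightarrow> length z \<le> d \<Longrightarrow> length z' \<le> d \<Longrightarrow>
      word_type k z = word_type k z' \<Longrightarrow> c (cs_apply V z) = c (cs_apply V z')"
proof -
  let ?A = "digits k \<union> L"
  have A: "finite ?A" "card ?A \<le> k + q" "digits k \<subseteq> ?A"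
  proof -
    show "finite ?A" using L(1) by (simp add: digits_def)
    have "card (digits k :: 'l letter set) \<le> k"
      using card_image_le[of "{1..k}" "Num :: nat \<Rightarrow> 'l letter"] by (simp add: digits_def)
    then show "card ?A \<le> k + q" using card_Un_le[of "digits k" L] L(2) by linarith
  qed simp
  define M where "M = FK_dim q d r"
  have k': "k - 1 < k" "Suc (k - 1) = k" using k by auto
  obtain U where U: "variable_seq k U" "length (snd U) = M" "total_length U \<le> FK_bound k q d r"
    and inv: "\<And>z z'. set z \<subseteq> ?A \<Longrightarrow> set z' \<subseteq> ?A \<Longrightarrow> length z \<le> M \<Longrightarrow>
      map (identify k) z = map (identify k) z' \<Longrightarrow> c (cs_apply U z) = c (cs_apply U z')"
    using identify_digits[where c = c and m = M, OF A c k'(1)]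
    unfolding k'(2) FK_bound_def M_def by blast
  define S where "S = {\<tau>. set \<tau> \<subseteq> L \<and> length \<tau> \<le> d}"
  have S: "finite S" "card S \<le> Suc q ^ d"
    unfolding S_def using finite_lists_length_le[OF L(1)] card_lists_le[OF L(1)] L(2) by auto
  have r: "0 < r" using c[of "[]"] by simp
  obtain e where e: "\<And>h. (\<And>x. h x < r) \<Longrightarrow> e h < r ^ (Suc q ^ d)"
    "\<And>h h' x. (\<And>x. h x < r) \<Longrightarrow> (\<And>x. h' x < r) \<Longrightarrow> e h = e h' \<Longrightarrow> x \<in> S \<Longrightarrow> h x = h' x"
    using vector_code[OF S r] by blast
  define g where "g E \<tau> = c (cs_apply U (map (letter_at (zip \<tau> E)) [0..<hd (last E)]))" for E \<tau>
  have g: "g E \<tau> < r" for E \<tau> using c by (simp add: g_def)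
  have "tuple_bound finite_unions_bound (Suc d) (Suc d) (r ^ (Suc q ^ d)) \<le> length (map (\<lambda>i. [i]) [0..<M])"
    by (simp add: M_def FK_dim_def)
  \<comment> \<open>Colouring by the whole vector \<open>g E\<close> settles all types at
    once.\<close>
  from milliken_taylor.tuples[of "\<lambda>E. e (g E)", OF e(1)[OF g] this]
  obtain D where D: "block_refines D (map (\<lambda>i. [i]) [0..<M])" "length D = Suc d"
    and mono: "\<And>P Q. block_refines P D \<Longrightarrow> block_refines Q D \<Longrightarrow> length P = length Q \<Longrightarrow>
      length P \<le> Suc d \<Longrightarrow> e (g P) = e (g Q)"
    by blast
  interpret block_sequence D by (rule block_sequence_singletons(1)[OF D(1)])
  let ?V = "block_word_seq D :: 'l cs_seq"
  have V: "variable_seq k ?V" "length (snd ?V) = d"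
    using variable_block_word_seq[OF k] D(2) by (auto simp: block_word_seq_def)
  have "D \<noteq> []" using D(2) by auto
  then have "hd (last D) \<in> set (concat D)" using hd_in[of d] D(2) by (auto simp: last_conv_nth)
  then have "hd (last D) < M" using block_sequence_singletons(2)[OF D(1)] by blast
  then have lV: "total_length ?V \<le> length (snd U)"
    using total_length_block_word_seq[OF \<open>D \<noteq> []\<close>] U(2) by (metis less_imp_le)
  have key: "\<exists>E. block_refines E D \<and> length E = Suc (length (word_type k z)) \<and>
      c (cs_apply U (cs_apply ?V z)) = g E (word_type k z)"
    if z: "set z \<subseteq> ?A" "length z \<le> d" for z
  proof -
    define ps where "ps = filter (\<lambda>p. fst p \<notin> digits k) (zip z D)"
    define T where "T = collapse ps"
    define E where "E = map snd T @ [D ! length z]"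
    have len: "length z < length D" using z(2) D(2) by simp
    have fst_zip: "map fst ps = filter (\<lambda>a. a \<notin> digits k) z"
    proof -
      have "map fst ps = filter (\<lambda>a. a \<notin> digits k) (map fst (zip z D))"
        by (simp add: ps_def filter_map comp_def)
      then show ?thesis using len by (simp add: map_fst_zip_take)
    qed
    then have T: "map fst T = word_type k z" by (simp add: T_def map_fst_collapse word_type_def)
    have "block_refines (map snd T) (map snd ps)" unfolding T_def by (rule block_refines_collapse)
    moreover have "block_refines (map snd ps) (take (length z) D)"
    proof (rule subseq_imp_block_refines)
      have "subseq (map snd ps) (map snd (zip z D))" unfolding ps_def by (intro subseq_map subseq_filter_left)
      then show "subseq (map snd ps) (take (length z) D)" using len by (simp add: map_snd_zip_take)
    qed
    ultimately have "block_refines (map snd T) (take (length z) D)" by (rule milliken_taylor.trans)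
    then have "block_refines E (take (length z) D @ [D ! length z])"
      unfolding E_def by (rule milliken_taylor.append[OF _ milliken_taylor.refl])
    then have "block_refines E (take (Suc (length z)) D)" using len by (simp add: take_Suc_conv_app_nth)
    then have ED: "block_refines E D"
      using milliken_taylor.append_right[of E "take (Suc (length z)) D" "drop (Suc (length z)) D"] by simp
    \<comment> \<open>\<open>E\<close> has one block more than the type has letters, and zipping
      drops it.\<close>
    have zipE: "zip (word_type k z) E = T"
      unfolding T[symmetric] E_def by (induction T) auto
    have disjoint: "sorted_wrt (\<lambda>p q. set (snd p) \<inter> set (snd q) = {}) (zip z D)"
      unfolding sorted_wrt_iff_nth_less
    proof (intro allI impI)
      fix i j assume "i < j" "j < length (zip z D)"
      then show "set (snd (zip z D ! i)) \<inter> set (snd (zip z D ! j)) = {}"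
        using less_of_less_index[of i j] by auto
    qed
    have "map (identify k) (cs_apply ?V z) = map (letter_at T) [0..<hd (D ! length z)]"
      unfolding cs_apply_block_word_seq[OF len] T_def ps_def
      using letter_at_filter_digits[OF k disjoint] by (simp add: letter_at_collapse)
    also have "\<dots> = map (letter_at (zip (word_type k z) E)) [0..<hd (last E)]"
      unfolding zipE by (simp add: E_def)
    finally have word: "map (identify k) (cs_apply ?V z) = map (letter_at (zip (word_type k z) E)) [0..<hd (last E)]" .
    have "set (cs_apply ?V z) \<subseteq> ?A" using set_cs_apply[OF V(1) A(3) z(1)] z(2) V(2) by simp
    moreover have "Num 1 \<in> digits k" using k by (auto simp: digits_def)
    moreover have "length (cs_apply ?V z) \<le> M" using length_cs_apply[of z ?V] lV V(2) U(2) z(2) by simp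
    moreover have "identify k (identify k b) = identify k b" for b :: "'l letter" by (simp add: identify_def)
    ultimately have "c (cs_apply U (cs_apply ?V z)) = c (cs_apply U (map (identify k) (cs_apply ?V z)))"
      by (intro inv) (auto simp: identify_def)
    then have "c (cs_apply U (cs_apply ?V z)) = g E (word_type k z)"
      unfolding g_def word[symmetric] .
    moreover have "length E = Suc (length (word_type k z))"
      unfolding T[symmetric] by (simp add: E_def)
    ultimately show ?thesis using ED by blast
  qed
  show ?thesis
  proof (rule that[of "cs_compose U ?V"])
    show "carlson_simpson k d (cs_compose U ?V)"
      using variable_seq_compose[OF U(1) V(1) lV] V(2) d by (simp add: carlson_simpson_iff cs_compose_def)
    show "total_length (cs_compose U ?V) \<le> FK_bound k q d r"
      using total_length_compose[of U ?V] U(3) by simp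
    fix z z'
    assume z: "set z \<subseteq> ?A" "set z' \<subseteq> ?A" "length z \<le> d" "length z' \<le> d" "word_type k z = word_type k z'"
    let ?\<tau> = "word_type k z"
    obtain E E' where E: "block_refines E D" "length E = Suc (length ?\<tau>)"
      "c (cs_apply U (cs_apply ?V z)) = g E ?\<tau>"
      and E': "block_refines E' D" "length E' = Suc (length ?\<tau>)"
      "c (cs_apply U (cs_apply ?V z')) = g E' ?\<tau>"
      using key[OF z(1,3)] key[OF z(2,4)] z(5) by metis
    have "length ?\<tau> \<le> length z"
      unfolding word_type_def using remdups_adj_length length_filter_le le_trans by blast
    moreover have "set ?\<tau> \<subseteq> L" using z(1) by (auto simp: word_type_def)
    ultimately have \<tau>: "?\<tau> \<in> S" "length E \<le> Suc d" using z(3) E(2) by (auto simp: S_def)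
    have "e (g E) = e (g E')" using mono[OF E(1) E'(1)] E(2) E'(2) \<tau>(2) by simp
    then have "g E ?\<tau> = g E' ?\<tau>" by (rule e(2)[OF g g _ \<tau>(1)])
    then show "c (cs_apply (cs_compose U ?V) z) = c (cs_apply (cs_compose U ?V) z')"
      using E(3) E'(3) z(3,4) V(2) by (simp add: cs_apply_compose[OF _ lV])
  qed
qed

lemma FK_property_FK_bound:
  assumes "1 \<le> k" "1 \<le> d" "1 \<le> r"
  shows "FK_property TYPE('l) k q d r (FK_bound k q d r)"
  unfolding FK_property_def
proof (intro allI impI)
  fix n and L :: "'l letter set" and W :: "'l cs_seq" and c :: "'l letter list \<Rightarrow> nat"
  assume n: "FK_bound k q d r \<le> n" and L: "finite L" "card L = q" "L \<inter> digits k = {}" "X \<notin> L"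
    and W: "carlson_simpson k n W" and c: "c ` cs_words k L W \<subseteq> {1..r}"
  \<comment> \<open>Colours are shifted from 1..r to numbers below r, with a default outside that
    range. The shift is injective only on 1..r, so the colours of the words of \<open>?V\<close> are
    shown to lie there before equality is transferred back.\<close>
  define c' where "c' u = (if c (cs_apply W u) \<in> {1..r} then c (cs_apply W u) - 1 else 0)" for u
  have c': "c' u < r" for u using assms(3) by (auto simp: c'_def)
  obtain V where V: "carlson_simpson k d V" "total_length V \<le> FK_bound k q d r" and
    hom: "\<And>z z'. set z \<subseteq> digits k \<union> L \<Longrightarrow> set z' \<subseteq> digits k \<union> L \<Longrightarrow> length z \<le> d \<Longrightarrow> length z' \<le> d \<Longrightarrow>
      word_type k z = word_type k z' \<Longrightarrow> c' (cs_apply V z) = c' (cs_apply V z')"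
    using ex_type_homogeneous[where c = c', OF assms(1,2) L(1-3) c'] by blast
  have V: "carlson_simpson k d V" "total_length V \<le> n" using V n by auto
  have VW: "total_length V \<le> length (snd W)" "variable_seq k W" "variable_seq k V" "length (snd V) = d"
    using V W by (auto simp: carlson_simpson_iff)
  let ?V = "cs_compose W V"
  have sub: "cs_subsequence k d ?V W" by (rule cs_subsequence_compose[OF W V assms(1)])
  then have V': "variable_seq k ?V" "length (snd ?V) = d"
    by (auto simp: cs_subsequence_def carlson_simpson_iff)
  have color: "c (cs_apply W u) \<in> {1..r}" if "set u \<subseteq> digits k \<union> L" "length u \<le> n" for u
  proof -
    have "cs_apply W u \<in> cs_words k L W"
      using that W by (auto simp: cs_words_def carlson_simpson_iff)
    then show ?thesis using c by blast
  qed
  show "\<exists>V. cs_subsequence k d V W \<and> (\<forall>\<tau>. is_type L \<tau> \<longrightarrow>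
      {u \<in> cs_words k L V. has_type k u \<tau>} = {} \<or> monochromatic c {u \<in> cs_words k L V. has_type k u \<tau>})"
  proof (intro exI[of _ ?V] conjI sub allI impI disjI2)
    fix \<tau>
    show "monochromatic c {u \<in> cs_words k L ?V. has_type k u \<tau>}"
      unfolding monochromatic_def
    proof (intro ballI)
      fix u u' assume u: "u \<in> {u \<in> cs_words k L ?V. has_type k u \<tau>}" "u' \<in> {u \<in> cs_words k L ?V. has_type k u \<tau>}"
      have word: "\<exists>z. set z \<subseteq> digits k \<union> L \<and> length z \<le> d \<and> u = cs_apply W (cs_apply V z) \<and>
          word_type k z = \<tau> \<and> c u \<in> {1..r}"
        if mem: "u \<in> {u \<in> cs_words k L ?V. has_type k u \<tau>}" for u
      proof -
        obtain z where z: "u = cs_apply ?V z" "set z \<subseteq> digits k \<union> L" "length z \<le> d"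
          using mem V'(2) by (auto simp: cs_words_def)
        have eq: "cs_apply ?V z = cs_apply W (cs_apply V z)"
          using z(3) VW by (intro cs_apply_compose) auto
        have "word_type k z = \<tau>"
          using mem z word_type_cs_apply[OF V'(1), of z] V'(2) by (simp add: has_type_def)
        moreover have "set (cs_apply V z) \<subseteq> digits k \<union> L"
          using z VW by (intro set_cs_apply) auto
        moreover have "length (cs_apply V z) \<le> n"
          using length_cs_apply[of z V] z(3) VW(4) V(2) by simp
        ultimately show ?thesis using z eq color[of "cs_apply V z"] by auto
      qed
      obtain z z' where z: "set z \<subseteq> digits k \<union> L" "length z \<le> d" "u = cs_apply W (cs_apply V z)"
          "word_type k z = \<tau>" "c u \<in> {1..r}"
        and z': "set z' \<subseteq> digits k \<union> L" "length z' \<le> d" "u' = cs_apply W (cs_apply V z')"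
          "word_type k z' = \<tau>" "c u' \<in> {1..r}"
        using word[OF u(1)] word[OF u(2)] by blast
      have "c' (cs_apply V z) = c' (cs_apply V z')" using z z' by (intro hom) auto
      then show "c u = c u'" using z z' by (auto simp: c'_def)
    qed
  qed
qed

section \<open>Growth of the bounds\<close>

text \<open>\<open>exI\<close> comes before \<open>allI\<close>, so the open count cannot depend on
  the quantified variables; the rules build up a constant while they take the term apart.\<close>

lemma box_bound_growth: "\<exists>c. \<forall>r M. box_bound r M \<le> E_iter 1 c (r + M)"
  unfolding box_bound_def
  by (rule exI, intro allI) (rule order_refl E_iter_leIs | (rule E_iter_leI_arg, simp))+

lemma folkman_bound_growth: "\<exists>c. \<forall>r j. folkman_bound r j \<le> E_iter 2 c (r + j)"
proof -
  obtain c where c: "\<And>r M. box_bound r M \<le> E_iter 1 c (r + M)" using box_bound_growth by blast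
  obtain c' where c': "\<And>r y. Suc y * box_bound r (Suc y) \<le> E_iter 1 c' (r + y)"
  proof -
    have "\<exists>c'. \<forall>r y. Suc y * box_bound r (Suc y) \<le> E_iter 1 c' (r + y)"
      by (rule exI, intro allI)
        (rule order_refl E_iter_leIs E_iter_leI_comp[OF c] | (rule E_iter_leI_arg, simp))+
    then show ?thesis using that by blast
  qed
  have "folkman_bound r j \<le> grz_E 2 (Suc (Suc c') * j + r)" for r j
    using iterate_le_grz_E[of j "folkman_bound r" 1 c' r] c' by (simp add: numeral_2_eq_2)
  then have *: "folkman_bound r j \<le> E_iter 2 1 (Suc (Suc c') * j + r)" for r j
    by (simp add: E_iter_def)
  show ?thesis
    by (rule exI, intro allI)
      (rule order_refl E_iter_leI_comp[OF *] E_iter_leIs E_iter_leI_const | (rule E_iter_leI_arg, simp))+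
qed

lemma end_bound_growth:
  assumes h: "\<And>m r. h m r \<le> E_iter i c (m + r)"
  shows "\<exists>c. \<forall>m r. end_bound h m 0 r \<le> E_iter (Suc i) c (m + r)"
proof -
  obtain c' where c': "\<And>a b y. b \<le> a \<Longrightarrow> h (Suc y) b \<le> E_iter i c' (a + y)"
  proof -
    have "\<exists>c'. \<forall>a b y. b \<le> a \<longrightarrow> h (Suc y) b \<le> E_iter i c' (a + y)"
      by (rule exI, intro allI impI)
        (rule order_refl E_iter_leIs E_iter_leI_comp[OF h] | (rule E_iter_leI_arg, simp))+
    then show ?thesis using that by blast
  qed
  have *: "end_bound h m 0 r \<le> E_iter (Suc i) 1 (Suc (Suc c') * m + Suc r ^ (3 ^ m))" for m r
  proof -
    let ?a = "Suc r ^ (3 ^ m)"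
    \<comment> \<open>The recursion increases \<open>j\<close> while m decreases; along j = m - t it
      is a plain iteration. \<open>?a\<close> bounds the number of colours at every stage, and
      \<open>Suc r\<close> keeps the power monotone in the exponent even for r = 0.\<close>
    define y where "y t = end_bound h t (m - t) r" for t
    have "y (Suc t) \<le> E_iter i c' (?a + y t)" if "t < m" for t
    proof -
      have "r ^ (3 ^ (m - Suc t)) \<le> Suc r ^ (3 ^ (m - Suc t))" by (intro power_mono) auto
      also have "\<dots> \<le> ?a" by (intro power_increasing) auto
      finally show ?thesis using c' that by (simp add: y_def Suc_diff_Suc)
    qed
    from iterate_le_grz_E[of m y i c' ?a, OF this] show ?thesis
      by (simp add: y_def E_iter_def)
  qed
  show ?thesis
    by (rule exI, intro allI)
      (rule order_refl E_iter_leI_comp[OF *] E_iter_leIs E_iter_leI_const | (rule E_iter_leI_arg, simp) | simp)+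
qed

lemma tuple_bound_growth:
  assumes h: "\<And>m r. h m r \<le> E_iter i c (m + r)"
  shows "\<exists>c. \<forall>s m r. tuple_bound h s m r \<le> E_iter (Suc (Suc i)) c (s + m + r)"
proof -
  obtain c where c: "\<And>m r. end_bound h m 0 r \<le> E_iter (Suc i) c (m + r)"
    using end_bound_growth[OF h] by blast
  obtain c' where c': "\<And>a b y. b \<le> a \<Longrightarrow> end_bound h (Suc y) 0 b \<le> E_iter (Suc i) c' (a + y)"
  proof -
    have "\<exists>c'. \<forall>a b y. b \<le> a \<longrightarrow> end_bound h (Suc y) 0 b \<le> E_iter (Suc i) c' (a + y)"
      by (rule exI, intro allI impI)
        (rule order_refl E_iter_leIs E_iter_leI_comp[OF c] | (rule E_iter_leI_arg, simp))+
    then show ?thesis using that by blast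
  qed
  have *: "tuple_bound h s m r \<le> E_iter (Suc (Suc i)) 1 (Suc (Suc c') * s + Suc r ^ (2 ^ s) + m)" for s m r
  proof -
    let ?a = "Suc r ^ (2 ^ s)"
    \<comment> \<open>The number of colours is squared whenever the length drops by one, which gives
      the exponent 2 ^ (s - t) at length t.\<close>
    define y where "y t = tuple_bound h t m (r ^ (2 ^ (s - t)))" for t
    have "y (Suc t) \<le> E_iter (Suc i) c' (?a + y t)" if "t < s" for t
    proof -
      let ?r = "r ^ (2 ^ (s - Suc t))"
      have "?r \<le> Suc r ^ (2 ^ (s - Suc t))" by (intro power_mono) auto
      also have "\<dots> \<le> ?a" by (intro power_increasing) auto
      finally have "?r \<le> ?a" .
      moreover have "?r * ?r = r ^ (2 ^ (s - t))"
        using that by (simp add: Suc_diff_Suc[symmetric] mult_2 flip: power_add)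
      ultimately show ?thesis using c' by (simp add: y_def)
    qed
    from iterate_le_grz_E[of s y "Suc i" c' ?a, OF this] show ?thesis
      by (simp add: y_def E_iter_def)
  qed
  show ?thesis
    by (rule exI, intro allI)
      (rule order_refl E_iter_leI_comp[OF *] E_iter_leIs E_iter_leI_const | (rule E_iter_leI_arg, simp) | simp)+
qed

lemma finite_unions_bound_growth: "\<exists>c. \<forall>m r. finite_unions_bound m r \<le> E_iter 2 c (m + r)"
proof -
  have "r * m \<le> E_iter 0 1 (m + r)" for m r
    using E_iter_leI_add_mult(2)[of r 0 0 "m + r" m 0] by simp
  from tuple_bound_growth[of "\<lambda>m r. r * m", OF this] obtain c where
    c: "\<And>s m r. tuple_bound (\<lambda>m r. r * m) s m r \<le> E_iter 2 c (s + m + r)"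
    by (auto simp: numeral_2_eq_2)
  obtain c' where c': "\<And>r j. folkman_bound r j \<le> E_iter 2 c' (r + j)"
    using folkman_bound_growth by blast
  show ?thesis
    unfolding finite_unions_bound_def Let_def
    by (rule exI, intro allI)
      (rule order_refl E_iter_leI_comp[OF c] E_iter_leI_comp[OF c'] E_iter_leIs | (rule E_iter_leI_arg, simp))+
qed

lemma FK_dim_growth: "\<exists>c. \<forall>q d r. FK_dim q d r \<le> E_iter 4 c (q + d + r)"
proof -
  obtain c where c: "\<And>m r. finite_unions_bound m r \<le> E_iter 2 c (m + r)"
    using finite_unions_bound_growth by blast
  obtain c where c: "\<And>s m r. tuple_bound finite_unions_bound s m r \<le> E_iter 4 c (s + m + r)"
    using tuple_bound_growth[OF c] by (auto simp: numeral_eq_Suc)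
  show ?thesis
    unfolding FK_dim_def
    by (rule exI, intro allI)
      (rule order_refl E_iter_leI_comp[OF c] E_iter_leIs | (rule E_iter_leI_arg, simp) | simp)+
qed

lemma merge_bound_growth: "\<exists>c. \<forall>K m r. merge_bound K m r \<le> E_iter 2 c (K + m + r)"
proof -
  have "\<exists>c. \<forall>K m M r. m \<le> M \<longrightarrow> r ^ (Suc K ^ m) \<le> E_iter 1 c (K + M + r)"
    by (rule exI, intro allI impI) (rule order_refl E_iter_leIs | (rule E_iter_leI_arg, simp))+
  then obtain c\<^sub>1 where c\<^sub>1: "\<And>K m M r. m \<le> M \<Longrightarrow> r ^ (Suc K ^ m) \<le> E_iter 1 c\<^sub>1 (K + M + r)"
    by blast
  have "\<exists>c. \<forall>K m M r. m \<le> M \<longrightarrow> K + M + r ^ (Suc K ^ (r ^ (Suc K ^ m))) \<le> E_iter 1 c (K + M + r)"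
    by (rule exI, intro allI impI) (rule order_refl E_iter_leIs | (rule E_iter_leI_arg, simp))+
  then obtain c\<^sub>2 where c\<^sub>2: "\<And>K m M r. m \<le> M \<Longrightarrow>
      K + M + r ^ (Suc K ^ (r ^ (Suc K ^ m))) \<le> E_iter 1 c\<^sub>2 (K + M + r)"
    by blast
  \<comment> \<open>Each round costs \<open>c\<^sub>2\<close> for the larger number of colours
    passed on, \<open>c\<^sub>1\<close> for \<open>N\<close> and one for the addition. The fixed
    bound \<open>M\<close> on m keeps K + M unchanged while m decreases.\<close>
  define C where "C = Suc (c\<^sub>1 + c\<^sub>2)"
  have "K + M + merge_bound K m r \<le> E_iter 1 (C * m) (K + M + r)" if "m \<le> M" for K M m r
    using that
  proof (induction m arbitrary: r)
    case (Suc m)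
    let ?x = "K + M + r" and ?N = "r ^ (Suc K ^ m)"
    let ?r = "r ^ (Suc K ^ ?N)"
    have "m \<le> M" using Suc.prems by simp
    have "K + M + merge_bound K m ?r \<le> E_iter 1 (C * m) (K + M + ?r)"
      using Suc.IH \<open>m \<le> M\<close> by blast
    then have "K + M + merge_bound K m ?r \<le> E_iter 1 (C * m + c\<^sub>2) ?x"
      using c\<^sub>2[OF \<open>m \<le> M\<close>] by (rule E_iter_leI_comp)
    also have "\<dots> \<le> E_iter 1 (C * m + (c\<^sub>1 + c\<^sub>2)) ?x" by (intro E_iter_mono_count) simp
    finally have 1: "K + M + merge_bound K m ?r \<le> E_iter 1 (C * m + (c\<^sub>1 + c\<^sub>2)) ?x" .
    have "?N \<le> E_iter 1 c\<^sub>1 ?x" by (rule c\<^sub>1[OF \<open>m \<le> M\<close>])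
    also have "\<dots> \<le> E_iter 1 (C * m + (c\<^sub>1 + c\<^sub>2)) ?x" by (intro E_iter_mono_count) simp
    finally have "(K + M + merge_bound K m ?r) + ?N \<le> E_iter 1 (Suc (C * m + (c\<^sub>1 + c\<^sub>2))) ?x"
      by (rule E_iter_leI_double(1)[OF 1])
    moreover have "Suc (C * m + (c\<^sub>1 + c\<^sub>2)) = C * Suc m" by (simp add: C_def)
    ultimately show ?case by (simp add: Let_def)
  qed simp
  then have "merge_bound K m r \<le> E_iter 1 (C * m) (K + m + r)" for K m r
    by (metis add_leD2 order_refl)
  from le_trans[OF this E_iter_le_grz_E_Suc]
  have *: "merge_bound K m r \<le> E_iter 2 1 (C * m + (K + m + r))" for K m r
    by (simp add: E_iter_def numeral_2_eq_2)
  show ?thesis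
    by (rule exI, intro allI)
      (rule order_refl E_iter_leI_comp[OF *] E_iter_leIs E_iter_leI_const | (rule E_iter_leI_arg, simp))+
qed

lemma identify_bound_eq: "identify_bound K r j m = ((\<lambda>m. merge_bound K m r) ^^ j) m"
  by (induction j arbitrary: m) (simp_all add: funpow_Suc_right del: funpow.simps(2))

lemma identify_bound_growth: "\<exists>c. \<forall>K r j m. identify_bound K r j m \<le> E_iter 3 c (K + r + j + m)"
proof -
  obtain c where c: "\<And>K m r. merge_bound K m r \<le> E_iter 2 c (K + m + r)"
    using merge_bound_growth by blast
  have *: "identify_bound K r j m \<le> E_iter 3 1 (Suc (Suc c) * j + (K + r) + m)" for K r j m
  proof -
    have "identify_bound K r (Suc t) m = merge_bound K (identify_bound K r t m) r" for t
      by (simp add: identify_bound_eq)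
    moreover have "K + identify_bound K r t m + r = K + r + identify_bound K r t m" for t by simp
    ultimately have "identify_bound K r (Suc t) m \<le> E_iter 2 c (K + r + identify_bound K r t m)" for t
      using c[of K "identify_bound K r t m" r] by metis
    from iterate_le_grz_E[of j "\<lambda>t. identify_bound K r t m", OF this] show ?thesis
      by (simp add: E_iter_def numeral_3_eq_3)
  qed
  show ?thesis
    by (rule exI, intro allI)
      (rule order_refl E_iter_leI_comp[OF *] E_iter_leIs E_iter_leI_const | (rule E_iter_leI_arg, simp))+
qed

lemma FK_bound_growth: "\<exists>c. \<forall>k q d r. FK_bound k q d r \<le> E_iter 4 c (k + q + d + r)"
proof -
  obtain c where "\<And>K r j m. identify_bound K r j m \<le> E_iter 3 c (K + r + j + m)"
    using identify_bound_growth by blast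
  then have c: "identify_bound K r j m \<le> E_iter 4 c (K + r + j + m)" for K r j m
    by (rule E_iter_leI_index) simp
  obtain c' where c': "\<And>q d r. FK_dim q d r \<le> E_iter 4 c' (q + d + r)" using FK_dim_growth by blast
  show ?thesis
    unfolding FK_bound_def
    by (rule exI, intro allI)
      (rule order_refl E_iter_leI_comp[OF c] E_iter_leI_comp[OF c'] E_iter_leIs | (rule E_iter_leI_arg, simp))+
qed

section \<open>Membership in the Grzegorczyk hierarchy\<close>

lemma grzegorczyk_add:
  assumes "0 < n" "grzegorczyk n m f" "grzegorczyk n m g"
  shows "grzegorczyk n m (\<lambda>xs. f xs + g xs)"
  using grzegorczyk.comp[of n "[f, g]" "\<lambda>xs. xs ! 0 + xs ! 1" m] grzegorczyk.E_zero[OF assms(1)] assms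
  by (simp add: numeral_2_eq_2)

lemma grzegorczyk_grz_E:
  assumes "Suc i < n" "grzegorczyk n m f"
  shows "grzegorczyk n m (\<lambda>xs. grz_E i (f xs))"
  using grzegorczyk.comp[of n "[f]" "\<lambda>xs. grz_E i (xs ! 0)" m] grzegorczyk.E_Suc[OF assms(1)] assms
  by simp

text \<open>The count \<open>c\<close> is fixed, so repeated composition with a generator suffices.
  For n = 6 the condition admits \<open>grz_E 4\<close>.\<close>

lemma grzegorczyk_E_iter:
  assumes "Suc i < n" "grzegorczyk n m f"
  shows "grzegorczyk n m (\<lambda>xs. E_iter i c (f xs))"
  using assms by (induction c) (auto simp: E_iter_Suc intro: grzegorczyk_grz_E)

section \<open>Primitive recursiveness of the bound\<close>

lemma primitive_recursive_comp1:
  assumes "primitive_recursive 1 (\<lambda>xs. f (xs ! 0))" "primitive_recursive m g"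
  shows "primitive_recursive m (\<lambda>xs. f (g xs))"
  using primitive_recursive.comp[of "[g]" "\<lambda>xs. f (xs ! 0)" m] assms by simp

lemma primitive_recursive_comp2:
  assumes "primitive_recursive 2 (\<lambda>xs. f (xs ! 0) (xs ! 1))" "primitive_recursive m g" "primitive_recursive m h"
  shows "primitive_recursive m (\<lambda>xs. f (g xs) (h xs))"
  using primitive_recursive.comp[of "[g, h]" "\<lambda>xs. f (xs ! 0) (xs ! 1)" m] assms
  by (simp add: numeral_2_eq_2)

lemma primitive_recursive_Suc:
  "primitive_recursive m g \<Longrightarrow> primitive_recursive m (\<lambda>xs. Suc (g xs))"
  by (rule primitive_recursive_comp1[OF primitive_recursive.succ])

lemma primitive_recursive_add:
  assumes "primitive_recursive m g" "primitive_recursive m h"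
  shows "primitive_recursive m (\<lambda>xs. g xs + h xs)"
proof -
  have "primitive_recursive (Suc 1) (\<lambda>xs. xs ! 0 + xs ! 1)"
    by (rule primitive_recursive.prec[of 1 "\<lambda>xs. xs ! 0" "\<lambda>xs. Suc (xs ! 1)"])
      (auto intro!: primitive_recursive.proj primitive_recursive_Suc)
  then show ?thesis using primitive_recursive_comp2[of "(+)" m g h] assms by (simp add: numeral_2_eq_2)
qed

lemma primitive_recursive_mult:
  assumes "primitive_recursive m g" "primitive_recursive m h"
  shows "primitive_recursive m (\<lambda>xs. g xs * h xs)"
proof -
  have "primitive_recursive (Suc 1) (\<lambda>xs. xs ! 0 * xs ! 1)"
    by (rule primitive_recursive.prec[of 1 "\<lambda>_. 0" "\<lambda>xs. xs ! 1 + xs ! 2"])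
      (auto intro!: primitive_recursive.proj primitive_recursive.zero primitive_recursive_add)
  then show ?thesis using primitive_recursive_comp2[of "(*)" m g h] assms by (simp add: numeral_2_eq_2)
qed

lemma primitive_recursive_grz_E: "primitive_recursive 1 (\<lambda>xs. grz_E i (xs ! 0))"
proof (induction i)
  case 0
  have "primitive_recursive 1 (\<lambda>xs. Suc (Suc (xs ! 0 * xs ! 0)))"
    by (intro primitive_recursive_Suc primitive_recursive_mult primitive_recursive.proj) auto
  then show ?case by (simp add: power2_eq_square)
next
  case (Suc i)
  have "primitive_recursive (Suc 0) (\<lambda>xs. grz_E (Suc i) (xs ! 0))"
    by (rule primitive_recursive.prec[of 0 "\<lambda>_. Suc (Suc 0)" "\<lambda>xs. grz_E i (xs ! 1)"])
      (auto intro!: primitive_recursive.zero primitive_recursive_Suc primitive_recursive.proj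
        primitive_recursive_comp1[OF Suc.IH])
  then show ?case by simp
qed

lemma primitive_recursive_E_iter:
  assumes "primitive_recursive m f"
  shows "primitive_recursive m (\<lambda>xs. E_iter i c (f xs))"
  using assms
  by (induction c) (auto simp: E_iter_Suc intro: primitive_recursive_comp1[OF primitive_recursive_grz_E])

lemma FK_property_mono: "FK_property T k q d r N \<Longrightarrow> N \<le> N' \<Longrightarrow> FK_property T k q d r N'"
  unfolding FK_property_def
  by (rule allI, rule impI) (drule spec, drule mp, erule order_trans, assumption, assumption)

theorem theorem1p4:
  shows "(\<forall>k q d r. 2 \<le> k \<and> 1 \<le> q \<and> 1 \<le> d \<and> 1 \<le> r \<longrightarrow>
            (\<exists>N > 0. FK_property TYPE('l) k q d r N)) \<and>
         (\<exists>\<phi>. primitive_recursive 4 \<phi> \<and> grzegorczyk 6 4 \<phi> \<and>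
            (\<forall>k q d r. 2 \<le> k \<and> 1 \<le> q \<and> 1 \<le> d \<and> 1 \<le> r \<longrightarrow>
               FK TYPE('l) k q d r \<le> \<phi> [k, q, d, r]))"
proof -
  obtain c where c: "\<And>k q d r. FK_bound k q d r \<le> E_iter 4 c (k + q + d + r)"
    using FK_bound_growth by blast
  \<comment> \<open>One iterate more than \<open>c\<close> makes \<open>N\<close> positive, as the
    definition of \<open>FK\<close> requires.\<close>
  define N where "N k q d r = E_iter 4 (Suc c) (k + q + d + r)" for k q d r
  have less: "FK_bound k q d r < N k q d r" for k q d r
    using c[of k q d r] less_grz_E[of "E_iter 4 c (k + q + d + r)" 4] by (simp add: N_def E_iter_Suc)
  have N: "0 < N k q d r" "FK_property TYPE('l) k q d r (N k q d r)"
    if "2 \<le> k \<and> 1 \<le> q \<and> 1 \<le> d \<and> 1 \<le> r" for k q d r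
  proof -
    show "0 < N k q d r" using less[of k q d r] by simp
    have "1 \<le> k" "1 \<le> d" "1 \<le> r" using that by auto
    from FK_property_mono[OF FK_property_FK_bound[OF this] less_imp_le[OF less]]
    show "FK_property TYPE('l) k q d r (N k q d r)" .
  qed
  let ?\<phi> = "\<lambda>xs. E_iter 4 (Suc c) (xs ! 0 + xs ! 1 + xs ! 2 + xs ! 3)"
  show ?thesis
  proof (intro conjI allI impI exI[of _ ?\<phi>])
    show "\<exists>N>0. FK_property TYPE('l) k q d r N" if "2 \<le> k \<and> 1 \<le> q \<and> 1 \<le> d \<and> 1 \<le> r" for k q d r
      using N[OF that] by blast
    show "primitive_recursive 4 ?\<phi>"
      by (intro primitive_recursive_E_iter primitive_recursive_add primitive_recursive.proj) auto
    show "grzegorczyk 6 4 ?\<phi>"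
      by (intro grzegorczyk_E_iter grzegorczyk_add grzegorczyk.proj) auto
    show "FK TYPE('l) k q d r \<le> ?\<phi> [k, q, d, r]" if "2 \<le> k \<and> 1 \<le> q \<and> 1 \<le> d \<and> 1 \<le> r" for k q d r
    proof -
      have "FK TYPE('l) k q d r \<le> N k q d r"
        unfolding FK_def by (rule Least_le) (use N[OF that] in blast)
      then show ?thesis by (simp add: N_def numeral_2_eq_2 numeral_3_eq_3)
    qed
  qed
qed

end
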